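(* Let $1\le p<\infty$ and let $\mu$ be the measure $d\mu(z)=h(|z|)\,dA(z)$ on $\mathbb{D}$, where $h:[0,1)\to[0,\infty)$ is an integrable function for which there exist positive constants $\alpha$ and $C$ such that $$h(|\sigma(z)|)\le C\,h(|z|)\,|\sigma'(z)|^{\alpha}\quad\text{for all } z\in\mathbb{D}\text{ and all }\sigma\in Aut(\mathbb{D}).$$ Assume that $\mu$ satisfies the standing axiom on $D^p_\mu$ stated in the context, and suppose also that the identity function $z\mapsto z$ belongs to $M_0(D^p_\mu)$. For $f\in\mathcal{H}(\mathbb{D})$ and $0<r<1$ let $f_r(z)=f(rz)$. Then for every $f\in\mathcal{H}(\mathbb{D})$ the following statements are equivalent: (a) $f$ belongs to $M_0(D^p_\mu)$; (b) $\lim_{r\to 1}\|f-f_r\|_{M(D^p_\mu)}=0$; (c) $f$ belongs to the closure of the polynomials in $M(D^p_\mu)$.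
   Context: $\mathbb{D}=\{z\in\mathbb{C}:|z|<1\}$; $dA=\frac1\pi\,dx\,dy$ is normalized Lebesgue area measure on $\mathbb{D}$; $\mathcal{H}(\mathbb{D})$ is the set of analytic functions on $\mathbb{D}$; $Aut(\mathbb{D})$ is the group of disk automorphisms, i.e. one-to-one analytic maps of $\mathbb{D}$ onto itself. For a positive Borel measure $\mu$ on $\mathbb{D}$ and $1\le p<\infty$, $D^p_\mu$ is the space of all $f\in\mathcal{H}(\mathbb{D})$ with $\|f\|_{D^p_\mu}^p=|f(0)|^p+\int_{\mathbb{D}}|f'|^p\,d\mu<\infty$. Standing axiom: $D^p_\mu$ is a Banach space and the point-evaluation functionals $f\mapsto f(\zeta)$ are uniformly bounded on $D^p_\mu$ for $\zeta$ in compact subsets of $\mathbb{D}$ (for each compact $K\subset\mathbb{D}$ there is $C_K$ with $|f(\zeta)|\le C_K\|f\|_{D^p_\mu}$ for all $\zeta\in K$, $f\in D^p_\mu$). $M(D^p_\mu)$ is the space of all $f\in\mathcal{H}(\mathbb{D})$ with $\|f\|_{M(D^p_\mu)}^p=|f(0)|^p+\sup_{\sigma\in Aut(\mathbb{D})}\int_{\mathbb{D}}|(f\circ\sigma)'|^p\,d\mu<\infty$. The little space is $$M_0(D^p_\mu)=\Big\{f\in M(D^p_\mu):\ \lim_{|\sigma(0)|\to1,\ \sigma\in Aut(\mathbb{D})}\int_{\mathbb{D}}|(f\circ\sigma)'|^p\,d\mu=0\Big\}.$$ *)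

theory Defs
  imports "HOL-Analysis.Analysis" "HOL-Computational_Algebra.Polynomial"
begin

(* A function on the disk is represented by any function on the complex plane that restricts
   to it.  Everything below depends only on the values inside the open disk. *)

abbreviation unit_disk :: "complex set" where
  "unit_disk \<equiv> ball 0 1"

definition analytic_disk :: "(complex \<Rightarrow> complex) set" where
  "analytic_disk = {f. f holomorphic_on unit_disk}"

definition disk_aut :: "(complex \<Rightarrow> complex) set" where
  "disk_aut = {\<sigma>. \<sigma> holomorphic_on unit_disk \<and> bij_betw \<sigma> unit_disk unit_disk}"

definition disk_area :: "complex measure" where
  "disk_area = scale_measure (ennreal (1 / pi)) (lebesgue_on unit_disk)"

(* The p-th root on the extended nonnegative reals, with infinite root of infinity. *)
definition ennroot :: "real \<Rightarrow> ennreal \<Rightarrow> ennreal" where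
  "ennroot p x = (if x = \<infinity> then \<infinity> else ennreal (enn2real x powr (1 / p)))"

definition dirichlet_int :: "real \<Rightarrow> complex measure \<Rightarrow> (complex \<Rightarrow> complex) \<Rightarrow> ennreal" where
  "dirichlet_int p \<mu> f = (\<integral>\<^sup>+ z. ennreal (cmod (deriv f z) powr p) \<partial>\<mu>)"

(* Norms take the value infinity exactly outside the corresponding space. *)

definition D_norm :: "real \<Rightarrow> complex measure \<Rightarrow> (complex \<Rightarrow> complex) \<Rightarrow> ennreal" where
  "D_norm p \<mu> f = ennroot p (ennreal (cmod (f 0) powr p) + dirichlet_int p \<mu> f)"

definition D_space :: "real \<Rightarrow> complex measure \<Rightarrow> (complex \<Rightarrow> complex) set" where
  "D_space p \<mu> = {f \<in> analytic_disk. D_norm p \<mu> f < \<infinity>}"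

definition M_norm :: "real \<Rightarrow> complex measure \<Rightarrow> (complex \<Rightarrow> complex) \<Rightarrow> ennreal" where
  "M_norm p \<mu> f = ennroot p (ennreal (cmod (f 0) powr p) +
     (SUP \<sigma>\<in>disk_aut. dirichlet_int p \<mu> (f \<circ> \<sigma>)))"

definition M_space :: "real \<Rightarrow> complex measure \<Rightarrow> (complex \<Rightarrow> complex) set" where
  "M_space p \<mu> = {f \<in> analytic_disk. M_norm p \<mu> f < \<infinity>}"

definition M0_space :: "real \<Rightarrow> complex measure \<Rightarrow> (complex \<Rightarrow> complex) set" where
  "M0_space p \<mu> = {f \<in> M_space p \<mu>.
     ((\<lambda>\<sigma>. dirichlet_int p \<mu> (f \<circ> \<sigma>)) \<longlongrightarrow> 0)
       (inf (filtercomap (\<lambda>\<sigma>. cmod (\<sigma> 0)) (at_left 1)) (principal disk_aut))}"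

definition M_closure ::
  "real \<Rightarrow> complex measure \<Rightarrow> (complex \<Rightarrow> complex) set \<Rightarrow> (complex \<Rightarrow> complex) set" where
  "M_closure p \<mu> S = {f \<in> M_space p \<mu>.
     \<forall>\<epsilon>>0. \<exists>g \<in> S \<inter> M_space p \<mu>. M_norm p \<mu> (\<lambda>z. f z - g z) < \<epsilon>}"

(* V with the norm N is a complex Banach space under the pointwise operations, where functions
   that agree on S are identified. *)
definition banach_function_space ::
  "'a set \<Rightarrow> ('a \<Rightarrow> complex) set \<Rightarrow> (('a \<Rightarrow> complex) \<Rightarrow> ennreal) \<Rightarrow> bool" where
  "banach_function_space S V N \<longleftrightarrow>
     (\<lambda>_. 0) \<in> V \<and>
     (\<forall>f\<in>V. \<forall>g\<in>V. (\<lambda>z. f z + g z) \<in> V \<and> N (\<lambda>z. f z + g z) \<le> N f + N g) \<and>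
     (\<forall>c. \<forall>f\<in>V. (\<lambda>z. c * f z) \<in> V \<and> N (\<lambda>z. c * f z) = ennreal (cmod c) * N f) \<and>
     (\<forall>f\<in>V. N f < \<infinity> \<and> (N f = 0 \<longleftrightarrow> (\<forall>z\<in>S. f z = 0))) \<and>
     (\<forall>F. (\<forall>n::nat. F n \<in> V) \<longrightarrow>
        (\<forall>\<epsilon>>0. \<exists>K. \<forall>m\<ge>K. \<forall>n\<ge>K. N (\<lambda>z. F m z - F n z) < \<epsilon>) \<longrightarrow>
        (\<exists>f\<in>V. (\<lambda>n. N (\<lambda>z. F n z - f z)) \<longlonglongrightarrow> 0))"

definition standing_axiom :: "real \<Rightarrow> complex measure \<Rightarrow> bool" where
  "standing_axiom p \<mu> \<longleftrightarrow>
     banach_function_space unit_disk (D_space p \<mu>) (D_norm p \<mu>) \<and>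
     (\<forall>K. compact K \<and> K \<subseteq> unit_disk \<longrightarrow>
        (\<exists>C\<ge>0. \<forall>\<zeta>\<in>K. \<forall>f\<in>D_space p \<mu>. ennreal (cmod (f \<zeta>)) \<le> ennreal C * D_norm p \<mu> f))"

end

(*
  Since h is radial, applying the hypothesis on h to the Moebius map exchanging 0 and a (at the
  points 0 and a) shows that h(|a|) is comparable to (1 - |a|^2)^alpha.  All norms may therefore
  be computed with the weighted area integral J g = int |g'|^p (1 - |z|^2)^alpha.

  For f in the little space, J ((f - f_zeta) o sigma) tends to 0 as zeta -> 1 on the unit circle,
  uniformly in sigma, where f_zeta(z) = f(zeta z): if sigma(0) is near the circle, both
  J (f o sigma) and J (f_zeta o sigma) are small; otherwise the derivative of sigma is bounded
  above and below and J ((f - f_zeta) o sigma) is at most a constant times J (f - f_zeta).  Since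
  r f'(r w) is the Poisson average of zeta f'(zeta w) over the circle, Jensen's inequality bounds
  J ((f - f_r) o sigma) by the Poisson average of J ((f - f_zeta) o sigma), which gives (b).
  Taylor polynomials of f_r converge together with their derivatives uniformly on the closed disk,
  whence (b) implies (c), and polynomials are in the little space because the identity is.
*)
theory Submission
  imports Defs "HOL-Complex_Analysis.Riemann_Mapping"
begin

subsection \<open>Disk automorphisms\<close>

text \<open>The obstacle is that z -> rz is not an automorphism, so the decay assumed of f says
  nothing directly about f_r o sigma. A rotation is an automorphism: f_zeta o sigma is f composed
  with zeta sigma, and |zeta sigma(0)| = |sigma(0)|, so boundedness and decay of f apply to it
  unchanged. The Poisson kernel at r then carries the rotation estimate over to r: it has mass 1,
  which handles zeta near 1, and it is uniformly small away from 1 as r -> 1, where boundedness of f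
  in the M-norm suffices. Dividing by h(0) in the comparison of weights requires h(0) > 0. This
  comes from definiteness of the norm in the standing axiom: h(0) = 0 would force the measure to
  vanish, and z -> z would be a nonzero function of norm 0. Only limits matter, so constants are not
  optimized: change of variables is an inequality with a distortion factor, and the triangle
  inequality for p-th powers costs 2^p. The term |f(0)| of the norm never interferes, because f -
  f_r vanishes at 0 and the approximating polynomials take the value f(0) there.\<close>

lemma one_minus_mult_cnj_nonzero:
  assumes "cmod a < 1" "cmod z < 1"
  shows "1 - cnj a * z \<noteq> 0"
proof
  assume "1 - cnj a * z = 0"
  then have "cmod (cnj a * z) = 1" by (metis eq_iff_diff_eq_0 norm_one)
  then show False using norm_mult_less[of "cnj a" 1 z 1] assms by simp
qed

lemma moebius_in_disk_aut:
  assumes "cmod a < 1"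
  shows "Moebius_function 0 a \<in> disk_aut"
proof -
  have "bij_betw (Moebius_function 0 a) (ball 0 1) (ball 0 1)"
    by (rule bij_betw_byWitness[where f'="Moebius_function 0 (-a)"])
       (use assms in \<open>auto simp: Moebius_function_compose Moebius_function_norm_lt_1\<close>)
  then show ?thesis
    using Moebius_function_holomorphic[OF assms] by (auto simp: disk_aut_def)
qed

lemma disk_aut_inverse:
  assumes "\<sigma> \<in> disk_aut"
  obtains \<tau> where "\<tau> \<in> disk_aut" "\<And>z. z \<in> unit_disk \<Longrightarrow> \<tau> (\<sigma> z) = z" "\<And>z. z \<in> unit_disk \<Longrightarrow> \<sigma> (\<tau> z) = z"
proof -
  have hol: "\<sigma> holomorphic_on unit_disk" and bij: "bij_betw \<sigma> unit_disk unit_disk"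
    using assms by (auto simp: disk_aut_def)
  have im: "\<sigma> ` unit_disk = unit_disk" and inj: "inj_on \<sigma> unit_disk"
    using bij by (auto simp: bij_betw_def)
  obtain \<tau> where hol': "\<tau> holomorphic_on unit_disk"
    and l: "\<And>z. z \<in> unit_disk \<Longrightarrow> \<tau> (\<sigma> z) = z"
    using holomorphic_has_inverse[OF hol open_ball inj] im by metis
  have r: "\<sigma> (\<tau> z) = z" if "z \<in> unit_disk" for z
    using that im l by (metis imageE)
  have m: "\<tau> z \<in> unit_disk" if "z \<in> unit_disk" for z
    using that im l by (metis imageE)
  have "bij_betw \<tau> unit_disk unit_disk"
    by (rule bij_betw_byWitness[where f'=\<sigma>]) (use l r im m in \<open>blast+\<close>)
  with hol' l r that show ?thesis by (auto simp: disk_aut_def)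
qed

lemma disk_aut_comp:
  assumes "\<sigma> \<in> disk_aut" "\<tau> \<in> disk_aut"
  shows "\<sigma> \<circ> \<tau> \<in> disk_aut"
  using assms by (auto simp: disk_aut_def intro: bij_betw_trans holomorphic_on_compose_gen bij_betw_imp_funcset
      dest: bij_betw_imp_surj_on)

lemma disk_aut_mem: "\<sigma> \<in> disk_aut \<Longrightarrow> z \<in> unit_disk \<Longrightarrow> \<sigma> z \<in> unit_disk"
  by (auto simp: disk_aut_def bij_betw_def)

lemma rotation_in_disk_aut:
  assumes "cmod \<zeta> = 1"
  shows "(\<lambda>z. \<zeta> * z) \<in> disk_aut"
proof -
  have "\<zeta> \<noteq> 0" using assms by auto
  have "bij_betw (\<lambda>z. \<zeta> * z) unit_disk unit_disk"
    by (rule bij_betw_byWitness[where f'="\<lambda>z. z / \<zeta>"])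
      (use assms \<open>\<zeta> \<noteq> 0\<close> in \<open>auto simp: norm_mult norm_divide\<close>)
  then show ?thesis by (auto simp: disk_aut_def intro!: holomorphic_intros)
qed

text \<open>Composing with a Moebius map that sends 0 to the zero \<open>a\<close> of
  \<open>\<sigma>\<close> gives an automorphism \<open>g\<close> fixing 0. The Schwarz lemma for
  \<open>g\<close> and for its inverse yields |g(1/2)| = 1/2, and equality at one nonzero point
  makes \<open>g\<close> a rotation.\<close>

lemma disk_aut_moebius:
  assumes "\<sigma> \<in> disk_aut"
  obtains a \<eta> where "cmod a < 1" "cmod \<eta> = 1"
    "\<And>z. z \<in> unit_disk \<Longrightarrow> \<sigma> z = \<eta> * (z - a) / (1 - cnj a * z)"
proof -
  obtain \<tau> where \<tau>: "\<tau> \<in> disk_aut" "\<And>z. z \<in> unit_disk \<Longrightarrow> \<tau> (\<sigma> z) = z" "\<And>z. z \<in> unit_disk \<Longrightarrow> \<sigma> (\<tau> z) = z"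
    using disk_aut_inverse[OF assms] by blast
  define a where "a = \<tau> 0"
  have a: "cmod a < 1" using disk_aut_mem[OF \<tau>(1), of 0] by (simp add: a_def)
  have \<sigma>a: "\<sigma> a = 0" using \<tau>(3)[of 0] by (simp add: a_def)
  define \<phi> where "\<phi> = Moebius_function 0 a"
  define \<psi> where "\<psi> = Moebius_function 0 (-a)"
  have \<phi>: "\<phi> \<in> disk_aut" and \<psi>: "\<psi> \<in> disk_aut"
    using a by (auto simp: \<phi>_def \<psi>_def intro: moebius_in_disk_aut)
  have \<psi>\<phi>: "\<psi> (\<phi> z) = z" if "z \<in> unit_disk" for z
    using that a by (auto simp: \<phi>_def \<psi>_def Moebius_function_compose)
  define g where "g = \<sigma> \<circ> \<psi>"
  have g: "g \<in> disk_aut" unfolding g_def by (rule disk_aut_comp[OF assms \<psi>])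
  have g0: "g 0 = 0" by (simp add: g_def \<psi>_def Moebius_function_of_zero \<sigma>a)
  obtain k where k: "k \<in> disk_aut" "\<And>z. z \<in> unit_disk \<Longrightarrow> k (g z) = z" "\<And>z. z \<in> unit_disk \<Longrightarrow> g (k z) = z"
    using disk_aut_inverse[OF g] by blast
  have k0: "k 0 = 0" using k(2)[of 0] g0 by simp
  have le: "cmod (u \<xi>) \<le> cmod \<xi>" if "u \<in> disk_aut" "u 0 = 0" "cmod \<xi> < 1" for u \<xi>
    by (rule Schwarz_Lemma(1)) (use that disk_aut_mem[OF that(1)] in \<open>auto simp: disk_aut_def\<close>)
  have "cmod (g (1/2)) = cmod (1/2)"
  proof (rule antisym)
    show "cmod (g (1/2)) \<le> cmod (1/2)" by (rule le[OF g g0]) simp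
    have "cmod (k (g (1/2))) \<le> cmod (g (1/2))"
      using disk_aut_mem[OF g, of "1/2"] by (intro le[OF k(1) k0]) auto
    then show "cmod (1/2) \<le> cmod (g (1/2))" using k(2)[of "1/2"] by simp
  qed
  then have "\<exists>z. cmod z < 1 \<and> z \<noteq> 0 \<and> cmod (g z) = cmod z"
    by (intro exI[of _ "1/2"]) auto
  then obtain \<eta> where \<eta>: "\<And>z. cmod z < 1 \<Longrightarrow> g z = \<eta> * z" "cmod \<eta> = 1"
    using Schwarz_Lemma(3)[of g 0] g g0 disk_aut_mem[OF g] by (auto simp: disk_aut_def)
  have "\<sigma> z = \<eta> * (z - a) / (1 - cnj a * z)" if "z \<in> unit_disk" for z
  proof -
    have "\<sigma> z = g (\<phi> z)" using \<psi>\<phi>[OF that] by (simp add: g_def)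
    also have "\<dots> = \<eta> * \<phi> z" using disk_aut_mem[OF \<phi> that] by (intro \<eta>) auto
    finally show ?thesis by (simp add: \<phi>_def Moebius_function_simple)
  qed
  with a \<eta>(2) that show ?thesis by blast
qed

text \<open>Division of |1 - cnj(a) z|^2 - |z - a|^2 = (1 - |z|^2)(1 - |a|^2) by the first term on
  its left.\<close>

lemma moebius_cmod_identity:
  assumes "cmod a < 1" "cmod z < 1"
  shows "1 - (cmod ((z - a) / (1 - cnj a * z)))\<^sup>2 = (1 - (cmod z)\<^sup>2) * ((1 - (cmod a)\<^sup>2) / (cmod (1 - cnj a * z))\<^sup>2)"
proof -
  have "complex_of_real ((cmod (1 - cnj a * z))\<^sup>2 - (cmod (z - a))\<^sup>2)
      = complex_of_real ((1 - (cmod z)\<^sup>2) * (1 - (cmod a)\<^sup>2))"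
    unfolding of_real_diff of_real_mult of_real_1 complex_norm_square
    by (simp add: algebra_simps)
  then have "(cmod (1 - cnj a * z))\<^sup>2 - (cmod (z - a))\<^sup>2 = (1 - (cmod z)\<^sup>2) * (1 - (cmod a)\<^sup>2)"
    using of_real_eq_iff by blast
  moreover have "cmod (1 - cnj a * z) \<noteq> 0"
    using one_minus_mult_cnj_nonzero[OF assms] by simp
  ultimately show ?thesis
    by (simp add: norm_divide power_divide field_simps)
qed

text \<open>Here \<open>a\<close> is the zero of \<open>\<sigma>\<close>. The last conclusion is
  equality in the Schwarz-Pick lemma; it is what relates powers of 1 - |z|^2 to powers of
  |sigma'|.\<close>

lemma disk_aut_deriv:
  assumes "\<sigma> \<in> disk_aut"
  obtains a where "cmod a = cmod (\<sigma> 0)" "cmod a < 1"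
    "\<And>z. z \<in> unit_disk \<Longrightarrow> cmod (deriv \<sigma> z) = (1 - (cmod a)\<^sup>2) / (cmod (1 - cnj a * z))\<^sup>2"
    "\<And>z. z \<in> unit_disk \<Longrightarrow> 1 - (cmod (\<sigma> z))\<^sup>2 = (1 - (cmod z)\<^sup>2) * cmod (deriv \<sigma> z)"
proof -
  obtain a \<eta> where a: "cmod a < 1" "cmod \<eta> = 1"
    and \<sigma>: "\<And>z. z \<in> unit_disk \<Longrightarrow> \<sigma> z = \<eta> * (z - a) / (1 - cnj a * z)"
    using disk_aut_moebius[OF assms] by blast
  have d: "cmod (deriv \<sigma> z) = (1 - (cmod a)\<^sup>2) / (cmod (1 - cnj a * z))\<^sup>2" if z: "z \<in> unit_disk" for z
  proof -
    have nz: "1 - cnj a * z \<noteq> 0" using one_minus_mult_cnj_nonzero a(1) z by auto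
    have "((\<lambda>z. \<eta> * (z - a) / (1 - cnj a * z)) has_field_derivative
        \<eta> * (1 - cnj a * a) / (1 - cnj a * z)^2) (at z)"
      using nz by (auto intro!: derivative_eq_intros simp: power2_eq_square field_simps)
    then have "(\<sigma> has_field_derivative \<eta> * (1 - cnj a * a) / (1 - cnj a * z)^2) (at z)"
      by (rule has_field_derivative_transform_within_open[OF _ open_ball z]) (simp add: \<sigma>)
    then have "deriv \<sigma> z = \<eta> * (1 - cnj a * a) / (1 - cnj a * z)^2" by (rule DERIV_imp_deriv)
    moreover have "1 - cnj a * a = complex_of_real (1 - (cmod a)\<^sup>2)"
      by (simp only: of_real_diff complex_norm_square of_real_1 mult.commute)
    moreover have "(cmod a)\<^sup>2 \<le> 1" using a by (simp add: power_le_one)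
    ultimately show ?thesis
      using a by (simp add: norm_divide norm_mult norm_power del: of_real_diff of_real_power)
  qed
  have "1 - (cmod (\<sigma> z))\<^sup>2 = (1 - (cmod z)\<^sup>2) * cmod (deriv \<sigma> z)" if "z \<in> unit_disk" for z
  proof -
    have "cmod (\<sigma> z) = cmod ((z - a) / (1 - cnj a * z))"
      using a by (simp add: \<sigma>[OF that] norm_mult norm_divide)
    then show ?thesis using moebius_cmod_identity[of a z] a d[OF that] that by simp
  qed
  moreover have "cmod a = cmod (\<sigma> 0)" using \<sigma>[of 0] a by (simp add: norm_mult)
  ultimately show ?thesis using that a d by blast
qed

text \<open>The point \<open>\<tau> 0\<close> is the zero \<open>a\<close> of
  \<open>\<sigma>\<close>, while \<open>\<sigma> 0\<close> is \<open>a\<close> up to a unimodular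
  factor. Hence a bound on |sigma(0)| controls the inverse equally well.\<close>

lemma disk_aut_inverse_0:
  assumes "\<sigma> \<in> disk_aut" "\<tau> \<in> disk_aut" "\<And>z. z \<in> unit_disk \<Longrightarrow> \<sigma> (\<tau> z) = z"
  shows "cmod (\<tau> 0) = cmod (\<sigma> 0)"
proof -
  obtain a \<eta> where a: "cmod a < 1" "cmod \<eta> = 1"
    and \<sigma>: "\<And>z. z \<in> unit_disk \<Longrightarrow> \<sigma> z = \<eta> * (z - a) / (1 - cnj a * z)"
    using disk_aut_moebius[OF assms(1)] by blast
  have m: "\<tau> 0 \<in> unit_disk" by (rule disk_aut_mem[OF assms(2)]) simp
  have "\<eta> * (\<tau> 0 - a) / (1 - cnj a * \<tau> 0) = 0" using \<sigma>[OF m] assms(3)[of 0] by simp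
  then have "\<tau> 0 = a" using one_minus_mult_cnj_nonzero[of a "\<tau> 0"] a m by auto
  then show ?thesis using \<sigma>[of 0] a by (simp add: norm_mult)
qed

text \<open>From 1 - |a| <= |1 - cnj(a) z| <= 1 + |a|, where |a| = |sigma(0)|. The second claim is a
  lower bound for |sigma'|, rewritten by the Schwarz-Pick equality as a comparison of
  weights.\<close>

lemma disk_aut_deriv_bounds:
  assumes "\<sigma> \<in> disk_aut" "cmod (\<sigma> 0) \<le> \<rho>" "\<rho> < 1" "z \<in> unit_disk"
  shows "cmod (deriv \<sigma> z) \<le> (1 + \<rho>) / (1 - \<rho>)"
    and "1 - (cmod z)\<^sup>2 \<le> (1 + \<rho>) / (1 - \<rho>) * (1 - (cmod (\<sigma> z))\<^sup>2)"
proof -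
  obtain a where a: "cmod a = cmod (\<sigma> 0)" "cmod a < 1"
    and d: "cmod (deriv \<sigma> z) = (1 - (cmod a)\<^sup>2) / (cmod (1 - cnj a * z))\<^sup>2"
    and e: "1 - (cmod (\<sigma> z))\<^sup>2 = (1 - (cmod z)\<^sup>2) * cmod (deriv \<sigma> z)"
    using disk_aut_deriv[OF assms(1)] assms(4) by metis
  define b where "b = cmod a"
  have b: "0 \<le> b" "b \<le> \<rho>" "b < 1" using a assms by (auto simp: b_def)
  have z: "cmod z < 1" using assms by simp
  have bz: "b * cmod z \<le> b" using b z by (simp add: mult_left_le)
  have lo: "1 - b \<le> cmod (1 - cnj a * z)"
    using norm_triangle_ineq2[of 1 "cnj a * z"] bz by (simp add: norm_mult b_def)
  have hi: "cmod (1 - cnj a * z) \<le> 1 + b"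
    using norm_triangle_ineq4[of 1 "cnj a * z"] bz by (simp add: norm_mult b_def)
  have "(1 - b\<^sup>2) / (cmod (1 - cnj a * z))\<^sup>2 \<le> (1 - b\<^sup>2) / (1 - b)\<^sup>2"
    using lo b by (intro divide_left_mono power_mono mult_pos_pos zero_less_power) (auto simp: power_le_one)
  also have "\<dots> = (1 + b) / (1 - b)"
    using b by (simp add: power2_eq_square square_diff_one_factored[of b, symmetric] divide_simps) (simp add: algebra_simps)
  also have "\<dots> \<le> (1 + \<rho>) / (1 - \<rho>)" using b assms by (intro frac_le) auto
  finally show "cmod (deriv \<sigma> z) \<le> (1 + \<rho>) / (1 - \<rho>)" by (simp add: d b_def)
  have "1 \<le> (1 + b) / (1 - b) * ((1 - b\<^sup>2) / (1 + b)\<^sup>2)"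
    using b by (simp add: power2_eq_square square_diff_one_factored[of b, symmetric] divide_simps) (simp add: algebra_simps)
  also have "\<dots> \<le> (1 + \<rho>) / (1 - \<rho>) * ((1 - b\<^sup>2) / (cmod (1 - cnj a * z))\<^sup>2)"
    using b lo hi assms
    by (intro mult_mono frac_le divide_left_mono power_mono mult_pos_pos zero_less_power) (auto simp: power_le_one)
  finally have "1 \<le> (1 + \<rho>) / (1 - \<rho>) * cmod (deriv \<sigma> z)" by (simp add: d b_def)
  moreover have "0 \<le> 1 - (cmod z)\<^sup>2" using z by (simp add: power_le_one)
  ultimately have "(1 - (cmod z)\<^sup>2) * 1 \<le> (1 - (cmod z)\<^sup>2) * ((1 + \<rho>) / (1 - \<rho>) * cmod (deriv \<sigma> z))"
    by (rule mult_left_mono)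
  then show "1 - (cmod z)\<^sup>2 \<le> (1 + \<rho>) / (1 - \<rho>) * (1 - (cmod (\<sigma> z))\<^sup>2)"
    by (simp add: e mult_ac)
qed

subsection \<open>Area distortion by disk automorphisms\<close>

text \<open>Coordinates of the plane, needed because the measure estimate for differentiable images
  concerns maps of \<open>real^2\<close> and their Jacobian matrices.\<close>

definition complex_of_vec :: "real^2 \<Rightarrow> complex" where
  "complex_of_vec x = Complex (x $ 1) (x $ 2)"

definition vec_of_complex :: "complex \<Rightarrow> real^2" where
  "vec_of_complex z = (\<chi> i. if i = 1 then Re z else Im z)"

lemma vec_of_complex_inverse [simp]: "complex_of_vec (vec_of_complex z) = z"
  by (simp add: complex_of_vec_def vec_of_complex_def)

lemma complex_of_vec_inverse [simp]: "vec_of_complex (complex_of_vec x) = x"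
  by (auto simp: complex_of_vec_def vec_of_complex_def vec_eq_iff forall_2)

lemma bounded_linear_complex_of_vec: "bounded_linear complex_of_vec"
proof -
  have "linear complex_of_vec"
    by (rule linearI) (auto simp: complex_of_vec_def complex_eq_iff)
  then show ?thesis by (simp add: linear_conv_bounded_linear)
qed

lemma bounded_linear_vec_of_complex: "bounded_linear vec_of_complex"
proof -
  have "linear vec_of_complex"
    by (rule linearI) (auto simp: vec_of_complex_def vec_eq_iff)
  then show ?thesis by (simp add: linear_conv_bounded_linear)
qed

lemma measurable_complex_of_vec [measurable]: "complex_of_vec \<in> borel_measurable borel"
  by (intro borel_measurable_continuous_onI linear_continuous_on bounded_linear_complex_of_vec)

text \<open>Lebesgue measure is determined by its values on boxes, and boxes pull back to boxes with
  the same side lengths.\<close>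

lemma lborel_distr_complex_of_vec: "distr lborel borel complex_of_vec = lborel"
proof (rule lborel_eqI[symmetric])
  fix l u :: complex
  assume "\<And>b. b \<in> Basis \<Longrightarrow> l \<bullet> b \<le> u \<bullet> b"
  from this[of 1] this[of \<i>] have le: "Re l \<le> Re u" "Im l \<le> Im u" by (auto simp: Basis_complex_def)
  have "complex_of_vec -` box l u = box (vec_of_complex l) (vec_of_complex u)"
    by (auto simp: mem_box_cart in_box_complex_iff complex_of_vec_def vec_of_complex_def forall_2)
  moreover have "emeasure lborel (box (vec_of_complex l) (vec_of_complex u))
      = ennreal ((Re u - Re l) * (Im u - Im l))"
    using le by (subst emeasure_lborel_box)
      (auto simp: Basis_vec_def vec_of_complex_def inner_axis UNIV_2 axis_eq_axis)
  ultimately show "emeasure (distr lborel borel complex_of_vec) (box l u) = (\<Prod>b\<in>Basis. (u - l) \<bullet> b)"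
    by (simp add: emeasure_distr Basis_complex_def)
qed simp

text \<open>With c the complex derivative at a point, this is the Jacobian determinant of a
  holomorphic map.\<close>

lemma det_complex_mult:
  "det (matrix (vec_of_complex \<circ> (\<lambda>h. c * h) \<circ> complex_of_vec)) = (cmod c)\<^sup>2"
  by (simp add: det_2 matrix_def vec_of_complex_def complex_of_vec_def axis_def cmod_power2)
     (simp add: power2_eq_square)

text \<open>The real Jacobian is |tau'|^2, so a bound \<open>K\<close> for it bounds the factor by
  which area grows. The work is to carry the estimate between \<open>complex\<close> with
  \<open>lborel\<close> and \<open>real^2\<close> with \<open>lebesgue\<close>.\<close>

lemma emeasure_holomorphic_image_le:
  assumes hol: "\<tau> holomorphic_on U" and U: "open U" and "B \<subseteq> U" and B: "B \<in> sets borel"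
    and fin: "emeasure lborel B < \<infinity>" and K: "\<And>z. z \<in> B \<Longrightarrow> (cmod (deriv \<tau> z))\<^sup>2 \<le> K"
    and im: "\<tau> ` B \<in> sets borel"
  shows "emeasure lborel (\<tau> ` B) \<le> ennreal K * emeasure lborel B"
proof -
  define g where "g = vec_of_complex \<circ> \<tau> \<circ> complex_of_vec"
  define S where "S = complex_of_vec -` B"
  have S: "S \<in> sets borel" using measurable_sets[OF measurable_complex_of_vec B] by (simp add: S_def)
  have tr: "emeasure lborel X = emeasure lborel (complex_of_vec -` X)" if "X \<in> sets borel" for X
    using that by (subst lborel_distr_complex_of_vec[symmetric]) (simp add: emeasure_distr)
  have eS: "emeasure lborel B = emeasure lborel S" using tr[OF B] by (simp add: S_def)
  have Sl: "S \<in> lmeasurable" using S fin eS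
    by (auto simp: fmeasurable_def)
  have der: "(g has_derivative (vec_of_complex \<circ> (\<lambda>h. deriv \<tau> (complex_of_vec x) * h) \<circ> complex_of_vec)) (at x within S)"
    if "x \<in> S" for x
  proof -
    have "(\<tau> has_field_derivative deriv \<tau> (complex_of_vec x)) (at (complex_of_vec x))"
      using that \<open>B \<subseteq> U\<close> by (intro holomorphic_derivI[OF hol U]) (auto simp: S_def)
    then have 1: "(\<tau> has_derivative (\<lambda>h. deriv \<tau> (complex_of_vec x) * h)) (at (complex_of_vec x))"
      by (simp add: has_field_derivative_def)
    have "(g has_derivative (vec_of_complex \<circ> ((\<lambda>h. deriv \<tau> (complex_of_vec x) * h) \<circ> complex_of_vec))) (at x)"
      unfolding g_def comp_assoc
      by (intro diff_chain_at 1 bounded_linear_imp_has_derivative bounded_linear_complex_of_vec bounded_linear_vec_of_complex)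
    then show ?thesis by (simp add: comp_assoc has_derivative_at_withinI)
  qed
  have bd: "\<bar>det (matrix (vec_of_complex \<circ> (\<lambda>h. deriv \<tau> (complex_of_vec x) * h) \<circ> complex_of_vec))\<bar> \<le> K"
    if "x \<in> S" for x
    using K[of "complex_of_vec x"] that by (simp add: det_complex_mult S_def)
  \<comment> \<open>The image theorem asks for an integrable Jacobian: here it is continuous and
    bounded by \<open>K\<close> on a set of finite measure.\<close>
  have "continuous_on S (\<lambda>x. (cmod (deriv \<tau> (complex_of_vec x)))\<^sup>2)"
    using continuous_on_compose2[OF holomorphic_on_imp_continuous_on[OF holomorphic_deriv[OF hol U]]
        linear_continuous_on[OF bounded_linear_complex_of_vec], of S] \<open>B \<subseteq> U\<close>
    by (auto simp: S_def intro!: continuous_on_power continuous_on_norm)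
  then have "(\<lambda>x. (cmod (deriv \<tau> (complex_of_vec x)))\<^sup>2) \<in> borel_measurable (lebesgue_on S)"
    using S by (intro continuous_imp_measurable_on_sets_lebesgue) auto
  then have "(\<lambda>x. (cmod (deriv \<tau> (complex_of_vec x)))\<^sup>2) integrable_on S"
    by (rule measurable_bounded_by_integrable_imp_integrable[where g="\<lambda>_. K"])
       (use Sl K in \<open>auto simp: S_def integrable_on_const\<close>)
  then have int: "(\<lambda>x. \<bar>det (matrix (vec_of_complex \<circ> (\<lambda>h. deriv \<tau> (complex_of_vec x) * h) \<circ> complex_of_vec))\<bar>)
      integrable_on S"
    by (simp add: det_complex_mult)
  note im' = measurable_bounded_differentiable_image[OF Sl der int bd] measure_bounded_differentiable_image[OF Sl der int bd]
  have gS: "g ` S = complex_of_vec -` (\<tau> ` B)"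
  proof (intro set_eqI iffI)
    fix y assume "y \<in> complex_of_vec -` (\<tau> ` B)"
    then obtain z where z: "z \<in> B" "complex_of_vec y = \<tau> z" by auto
    then have "y = g (vec_of_complex z)" by (simp add: g_def flip: z(2))
    then show "y \<in> g ` S" using z(1) by (auto simp: S_def)
  qed (auto simp: g_def S_def)
  have "emeasure lborel (\<tau> ` B) = emeasure lebesgue (g ` S)"
    using tr[OF im] measurable_sets[OF measurable_complex_of_vec im] by (simp add: gS)
  also have "\<dots> = ennreal (measure lebesgue (g ` S))"
    using im'(1) by (intro emeasure_eq_measure2)
  also have "\<dots> \<le> ennreal (K * measure lebesgue S)"
    using im'(2) by (intro ennreal_leI)
  also have "\<dots> \<le> ennreal K * emeasure lborel B"
  proof (cases "K \<ge> 0")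
    case True
    have "emeasure lborel B = ennreal (measure lebesgue S)"
      using emeasure_eq_measure2[OF Sl] S by (simp add: eS)
    with True show ?thesis by (simp add: ennreal_mult)
  \<comment> \<open>For negative \<open>K\<close> the product \<open>K * measure lebesgue S\<close>
    is at most 0 and \<open>ennreal\<close> truncates it to 0.\<close>
  qed (simp add: ennreal_neg mult_nonpos_nonneg)
  finally show ?thesis .
qed

text \<open>The image of area on the disk under \<open>\<sigma>\<close> is at most \<open>K\<close>
  times area: the preimage of A is tau(A), and |tau'|^2 <= K because |tau(0)| = |sigma(0)|. For
  \<rho> = 0 the factor is 1, which covers rotations.\<close>

lemma nn_integral_disk_aut_le:
  assumes \<sigma>: "\<sigma> \<in> disk_aut" and \<rho>: "cmod (\<sigma> 0) \<le> \<rho>" "\<rho> < 1"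
    and G: "G \<in> borel_measurable borel"
  shows "(\<integral>\<^sup>+z\<in>unit_disk. G (\<sigma> z) \<partial>lborel) \<le> ennreal (((1 + \<rho>) / (1 - \<rho>))\<^sup>2) * (\<integral>\<^sup>+z\<in>unit_disk. G z \<partial>lborel)"
proof -
  obtain \<tau> where \<tau>: "\<tau> \<in> disk_aut" "\<And>z. z \<in> unit_disk \<Longrightarrow> \<tau> (\<sigma> z) = z" "\<And>z. z \<in> unit_disk \<Longrightarrow> \<sigma> (\<tau> z) = z"
    using disk_aut_inverse[OF \<sigma>] by blast
  have \<tau>0: "cmod (\<tau> 0) \<le> \<rho>" using disk_aut_inverse_0[OF \<sigma> \<tau>(1) \<tau>(3)] \<rho> by simp
  \<comment> \<open>Outside the disk \<open>\<sigma>\<close> is arbitrary, so it is measurable only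
    as a self-map of the restricted space.\<close>
  define M where "M = restrict_space (lborel :: complex measure) unit_disk"
  define K where "K = ((1 + \<rho>) / (1 - \<rho>))\<^sup>2"
  have sM: "sets M = sets (restrict_space borel unit_disk)" "space M = unit_disk"
    by (auto simp: M_def sets_restrict_space space_restrict_space)
  have "continuous_on unit_disk \<sigma>" using \<sigma> by (auto simp: disk_aut_def intro: holomorphic_on_imp_continuous_on)
  then have "\<sigma> \<in> borel_measurable (restrict_space borel unit_disk)"
    by (rule borel_measurable_continuous_on_restrict)
  then have "\<sigma> \<in> borel_measurable M" using sM(1) measurable_cong_sets by blast
  then have \<sigma>m: "\<sigma> \<in> measurable M M"
    unfolding M_def using disk_aut_mem[OF \<sigma>]
    by (intro measurable_restrict_space2) (auto simp: M_def space_restrict_space)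
  have "distr M M \<sigma> \<le> scale_measure (ennreal K) M"
  proof (subst le_measure)
    show "\<forall>A\<in>sets (distr M M \<sigma>). emeasure (distr M M \<sigma>) A \<le> emeasure (scale_measure (ennreal K) M) A"
    proof
      fix A assume "A \<in> sets (distr M M \<sigma>)"
      then have A: "A \<in> sets M" by simp
      then have Ab: "A \<in> sets borel" "A \<subseteq> unit_disk"
        by (auto simp: M_def sets_restrict_space_iff)
      \<comment> \<open>The preimage becomes a forward image, the form in which area distortion was
        estimated.\<close>
      have pre: "\<sigma> -` A \<inter> space M = \<tau> ` A"
        using \<tau> Ab(2) disk_aut_mem[OF \<tau>(1)] disk_aut_mem[OF \<sigma>] unfolding sM
        by (auto simp: image_iff subset_iff) metis+
      have mA: "\<tau> ` A \<in> sets M" using measurable_sets[OF \<sigma>m A] pre by simp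
      then have mAb: "\<tau> ` A \<in> sets borel" "\<tau> ` A \<subseteq> unit_disk"
        by (auto simp: M_def sets_restrict_space_iff)
      have "emeasure (distr M M \<sigma>) A = emeasure lborel (\<tau> ` A)"
        using emeasure_distr[OF \<sigma>m A] mAb by (simp add: pre) (simp add: M_def emeasure_restrict_space)
      also have "\<dots> \<le> ennreal K * emeasure lborel A"
      proof (rule emeasure_holomorphic_image_le[of _ unit_disk])
        show "emeasure lborel A < \<infinity>"
          using emeasure_mono[OF Ab(2), of lborel] emeasure_lborel_ball_finite[of "0::complex" 1] by auto
        fix z assume "z \<in> A"
        then have "cmod (deriv \<tau> z) \<le> (1 + \<rho>) / (1 - \<rho>)"
          using disk_aut_deriv_bounds(1)[OF \<tau>(1) \<tau>0 \<rho>(2)] Ab by auto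
        then show "(cmod (deriv \<tau> z))\<^sup>2 \<le> K" unfolding K_def by (intro power_mono) auto
      qed (use \<tau> Ab mAb in \<open>auto simp: disk_aut_def\<close>)
      also have "\<dots> = emeasure (scale_measure (ennreal K) M) A"
        using Ab by (simp add: M_def emeasure_restrict_space)
      finally show "emeasure (distr M M \<sigma>) A \<le> emeasure (scale_measure (ennreal K) M) A" .
    qed
  qed auto
  then have "integral\<^sup>N (distr M M \<sigma>) G \<le> integral\<^sup>N (scale_measure (ennreal K) M) G"
    by (intro nn_integral_mono_measure) auto
  moreover have Gm: "G \<in> borel_measurable M"
    using G by (simp add: M_def measurable_restrict_space1)
  ultimately have "(\<integral>\<^sup>+z. G (\<sigma> z) \<partial>M) \<le> ennreal K * (\<integral>\<^sup>+z. G z \<partial>M)"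
    using \<sigma>m by (simp add: nn_integral_distr nn_integral_scale_measure)
  then show ?thesis unfolding M_def K_def by (simp add: nn_integral_restrict_space)
qed

subsection \<open>Comparison with the standard weight\<close>

text \<open>In polar coordinates the set lies in the image of the null set N x R under a
  differentiable map of the plane, and such maps preserve null sets.\<close>

lemma negligible_cmod_vimage:
  assumes "N \<in> null_sets lborel"
  shows "negligible {z::complex. cmod z \<in> N}"
proof -
  have "N \<times> UNIV \<in> null_sets (lborel \<Otimes>\<^sub>M (lborel :: real measure))"
    using assms by (intro lborel.times_in_null_sets1) auto
  then have "N \<times> (UNIV :: real set) \<in> null_sets lebesgue"
    by (auto simp: lborel_prod intro: null_sets_completionI)
  then have "negligible (N \<times> (UNIV :: real set))"
    by (simp add: negligible_iff_null_sets)
  moreover have "(\<lambda>x::real\<times>real. (fst x * cos (snd x)) *\<^sub>R 1 + (fst x * sin (snd x)) *\<^sub>R \<i>) differentiable_on N \<times> UNIV"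
    unfolding differentiable_on_def differentiable_def
    by (intro ballI exI) (rule derivative_eq_intros refl)+
  ultimately have "negligible ((\<lambda>x::real\<times>real. (fst x * cos (snd x)) *\<^sub>R 1 + (fst x * sin (snd x)) *\<^sub>R \<i>) ` (N \<times> UNIV))"
    by (intro negligible_differentiable_image_negligible) auto
  moreover have "{z::complex. cmod z \<in> N} \<subseteq> (\<lambda>x::real\<times>real. (fst x * cos (snd x)) *\<^sub>R 1 + (fst x * sin (snd x)) *\<^sub>R \<i>) ` (N \<times> UNIV)"
  proof
    fix z :: complex assume "z \<in> {z. cmod z \<in> N}"
    moreover have "z = (cmod z * cos (Arg z)) *\<^sub>R 1 + (cmod z * sin (Arg z)) *\<^sub>R \<i>"
      using rcis_cmod_Arg[of z] by (auto simp: complex_eq_iff rcis_def)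
    ultimately show "z \<in> (\<lambda>x::real\<times>real. (fst x * cos (snd x)) *\<^sub>R 1 + (fst x * sin (snd x)) *\<^sub>R \<i>) ` (N \<times> UNIV)"
      by (intro image_eqI[of _ _ "(cmod z, Arg z)"]) auto
  qed
  ultimately show ?thesis by (rule negligible_subset)
qed

text \<open>Composing a Lebesgue measurable function with a continuous one need not preserve
  measurability. Here \<open>k\<close> agrees with a Borel function off a null set, whose preimage
  under \<open>cmod\<close> is null again.\<close>

lemma borel_measurable_lebesgue_radial:
  fixes k :: "real \<Rightarrow> real"
  assumes "k \<in> borel_measurable lebesgue"
  shows "(\<lambda>z::complex. k (cmod z)) \<in> borel_measurable lebesgue"
proof -
  obtain g where g: "g \<in> borel_measurable lborel" "AE x in lborel. k x = g x"
    using completion_ex_borel_measurable_real[OF assms] by blast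
  from g(2) obtain N where N: "N \<in> null_sets lborel" "{x. k x \<noteq> g x} \<subseteq> N"
    by (auto elim!: AE_E simp: null_sets_def)
  have "{z::complex. cmod z \<in> N} \<in> null_sets lebesgue"
    using negligible_cmod_vimage[OF N(1)] by (simp add: negligible_iff_null_sets)
  then have "AE z::complex in lebesgue. g (cmod z) = k (cmod z)"
    using N(2) by (intro AE_I'[of "{z. cmod z \<in> N}"]) auto
  moreover have "(\<lambda>z::complex. g (cmod z)) \<in> borel_measurable lebesgue"
    using measurable_compose[of cmod borel borel g borel] g(1)
    by (intro measurable_completion) simp
  ultimately show ?thesis
    by (rule borel_measurable_AE[rotated])
qed

text \<open>The argument stands for a derivative: the integral J g of the overview is
  \<open>bergman_int p \<alpha> (deriv g)\<close>. Area is not normalized here; the factor 1/pi goes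
  into the comparison constants.\<close>

definition bergman_int :: "real \<Rightarrow> real \<Rightarrow> (complex \<Rightarrow> complex) \<Rightarrow> ennreal" where
  "bergman_int p \<alpha> g = (\<integral>\<^sup>+z\<in>unit_disk. ennreal (cmod (g z) powr p * (1 - (cmod z)\<^sup>2) powr \<alpha>) \<partial>lborel)"

lemma bergman_int_cong:
  "(\<And>z. z \<in> unit_disk \<Longrightarrow> f z = g z) \<Longrightarrow> bergman_int p \<alpha> f = bergman_int p \<alpha> g"
  unfolding bergman_int_def by (intro nn_integral_cong) (auto split: split_indicator)

lemma borel_measurable_ennreal_indicator:
  fixes F :: "'a::topological_space \<Rightarrow> real"
  assumes "A \<in> sets borel" "continuous_on A F"
  shows "(\<lambda>z. ennreal (F z) * indicator A z) \<in> borel_measurable borel"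
proof -
  have "(\<lambda>z. indicator A z *\<^sub>R F z) \<in> borel_measurable borel"
    by (rule borel_measurable_continuous_on_indicator[OF assms])
  then have "(\<lambda>z. ennreal (indicator A z *\<^sub>R F z)) \<in> borel_measurable borel"
    by (rule measurable_compose[OF _ measurable_ennreal])
  also have "(\<lambda>z. ennreal (indicator A z *\<^sub>R F z)) = (\<lambda>z. ennreal (F z) * indicator A z)"
    by (auto split: split_indicator)
  finally show ?thesis .
qed

lemma bergman_integrand_measurable:
  assumes "continuous_on unit_disk g" "0 < p"
  shows "(\<lambda>z. ennreal (cmod (g z) powr p * (1 - (cmod z)\<^sup>2) powr \<alpha>) * indicator unit_disk z) \<in> borel_measurable borel"
proof (rule borel_measurable_ennreal_indicator)
  have "continuous_on unit_disk (\<lambda>z. cmod (g z) powr p)"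
    using assms(2) by (intro continuous_on_powr'[OF continuous_on_norm[OF assms(1)] continuous_on_const]) simp
  moreover have "continuous_on unit_disk (\<lambda>z::complex. (1 - (cmod z)\<^sup>2) powr \<alpha>)"
  proof (intro continuous_on_powr continuous_intros ballI)
    fix z :: complex assume "z \<in> unit_disk"
    then have "(cmod z)\<^sup>2 < 1" by (simp add: abs_square_less_1)
    then show "1 - (cmod z)\<^sup>2 \<noteq> 0" by linarith
  qed
  ultimately show "continuous_on unit_disk (\<lambda>z. cmod (g z) powr p * (1 - (cmod z)\<^sup>2) powr \<alpha>)"
    by (rule continuous_on_mult)
qed simp

lemma bergman_int_mono:
  assumes "\<And>z. z \<in> unit_disk \<Longrightarrow> cmod (f z) powr p \<le> c * cmod (g z) powr p" "0 \<le> c"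
    and g: "continuous_on unit_disk g" and p: "0 < p"
  shows "bergman_int p \<alpha> f \<le> ennreal c * bergman_int p \<alpha> g"
proof -
  have "bergman_int p \<alpha> f \<le> (\<integral>\<^sup>+z. ennreal c * (ennreal (cmod (g z) powr p * (1 - (cmod z)\<^sup>2) powr \<alpha>) * indicator unit_disk z) \<partial>lborel)"
    unfolding bergman_int_def using assms(1,2)
    by (intro nn_integral_mono) (auto split: split_indicator simp: mult.assoc[symmetric] ennreal_mult[symmetric] intro!: ennreal_leI mult_right_mono)
  also have "\<dots> = ennreal c * bergman_int p \<alpha> g"
    unfolding bergman_int_def using bergman_integrand_measurable[OF g p]
    by (intro nn_integral_cmult) simp
  finally show ?thesis .
qed

text \<open>A crude substitute for Minkowski's inequality, from |a + b| <= 2 max(|a|, |b|).\<close>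

lemma norm_add_powr_le:
  assumes "0 < p"
  shows "norm (a + b) powr p \<le> 2 powr p * (norm a powr p + norm b powr p)"
proof -
  have "norm (a + b) \<le> 2 * max (norm a) (norm b)" using norm_triangle_ineq[of a b] by linarith
  then have "norm (a + b) powr p \<le> (2 * max (norm a) (norm b)) powr p"
    using assms by (intro powr_mono2) auto
  also have "\<dots> = 2 powr p * max (norm a) (norm b) powr p" by (simp add: powr_mult)
  also have "\<dots> \<le> 2 powr p * (norm a powr p + norm b powr p)"
    by (intro mult_left_mono) (auto simp: max_def)
  finally show ?thesis .
qed

lemma bergman_int_add_le:
  assumes f: "continuous_on unit_disk f" and g: "continuous_on unit_disk g" and p: "0 < p"
    and le: "\<And>z. z \<in> unit_disk \<Longrightarrow> cmod (u z) \<le> cmod (f z + g z)"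
  shows "bergman_int p \<alpha> u \<le> ennreal (2 powr p) * (bergman_int p \<alpha> f + bergman_int p \<alpha> g)"
proof -
  note m = bergman_integrand_measurable[OF f p, of \<alpha>] bergman_integrand_measurable[OF g p, of \<alpha>]
  have *: "cmod (u z) powr p * w \<le> 2 powr p * (cmod (f z) powr p * w + cmod (g z) powr p * w)"
    if "z \<in> unit_disk" "0 \<le> w" for z w
  proof -
    have "cmod (u z) powr p * w \<le> cmod (f z + g z) powr p * w"
      using le[OF that(1)] p that by (intro mult_right_mono powr_mono2) auto
    also have "\<dots> \<le> 2 powr p * (cmod (f z) powr p + cmod (g z) powr p) * w"
      using norm_add_powr_le[OF p] that by (intro mult_right_mono) auto
    finally show ?thesis by (simp add: algebra_simps)
  qed
  have "bergman_int p \<alpha> u \<le> (\<integral>\<^sup>+z. ennreal (2 powr p) *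
      (ennreal (cmod (f z) powr p * (1 - (cmod z)\<^sup>2) powr \<alpha>) * indicator unit_disk z +
       ennreal (cmod (g z) powr p * (1 - (cmod z)\<^sup>2) powr \<alpha>) * indicator unit_disk z) \<partial>lborel)"
    unfolding bergman_int_def
    by (intro nn_integral_mono)
       (auto split: split_indicator simp: ennreal_plus[symmetric] ennreal_mult[symmetric] * simp del: ennreal_plus intro!: ennreal_leI)
  also have "\<dots> = ennreal (2 powr p) * (bergman_int p \<alpha> f + bergman_int p \<alpha> g)"
    unfolding bergman_int_def using m by (simp add: nn_integral_cmult nn_integral_add)
  finally show ?thesis .
qed

text \<open>The map \<open>\<phi>\<close> takes 0 to -z and z to 0. By the Schwarz-Pick equality
  |phi'(0)| = 1 - |z|^2 and |phi'(z)| is its reciprocal; the two bounds are the hypothesis on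
  \<open>h\<close> at these two points.\<close>

lemma radial_weight_bounds:
  fixes h :: "real \<Rightarrow> real"
  assumes C: "0 < C"
    and h_aut: "\<And>\<sigma> z. \<sigma> \<in> disk_aut \<Longrightarrow> z \<in> unit_disk \<Longrightarrow>
      h (cmod (\<sigma> z)) \<le> C * h (cmod z) * cmod (deriv \<sigma> z) powr \<alpha>"
    and z: "z \<in> unit_disk"
  shows "h (cmod z) \<le> C * h 0 * (1 - (cmod z)\<^sup>2) powr \<alpha>"
    and "h 0 * (1 - (cmod z)\<^sup>2) powr \<alpha> \<le> C * h (cmod z)"
proof -
  define \<phi> where "\<phi> = Moebius_function 0 z"
  have \<phi>: "\<phi> \<in> disk_aut" using z by (simp add: \<phi>_def moebius_in_disk_aut)
  have \<phi>0: "\<phi> 0 = - z" and \<phi>z: "\<phi> z = 0"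
    by (simp_all add: \<phi>_def Moebius_function_of_zero Moebius_function_eq_zero)
  obtain a where a: "\<And>z. z \<in> unit_disk \<Longrightarrow> 1 - (cmod (\<phi> z))\<^sup>2 = (1 - (cmod z)\<^sup>2) * cmod (deriv \<phi> z)"
    using disk_aut_deriv[OF \<phi>] by metis
  have d0: "cmod (deriv \<phi> 0) = 1 - (cmod z)\<^sup>2" using a[of 0] \<phi>0 by simp
  have pos: "1 - (cmod z)\<^sup>2 > 0" using z by (simp add: abs_square_less_1)
  then have dz: "cmod (deriv \<phi> z) = 1 / (1 - (cmod z)\<^sup>2)" using a[OF z] \<phi>z by (simp add: field_simps)
  show "h (cmod z) \<le> C * h 0 * (1 - (cmod z)\<^sup>2) powr \<alpha>"
    using h_aut[OF \<phi>, of 0] by (simp add: \<phi>0 d0)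
  have "h 0 \<le> C * h (cmod z) * (1 / (1 - (cmod z)\<^sup>2)) powr \<alpha>"
    using h_aut[OF \<phi> z] by (simp add: \<phi>z dz)
  then show "h 0 * (1 - (cmod z)\<^sup>2) powr \<alpha> \<le> C * h (cmod z)"
    using pos by (simp add: powr_divide field_simps)
qed

lemma dirichlet_int_eq:
  fixes h :: "real \<Rightarrow> real"
  assumes h: "set_integrable lebesgue {0..<1} h"
    and \<mu>: "\<mu> = density disk_area (\<lambda>z. ennreal (h (cmod z)))"
    and f: "f \<in> analytic_disk" and p: "0 \<le> p"
  shows "dirichlet_int p \<mu> f = ennreal (1 / pi) *
    (\<integral>\<^sup>+z. ennreal (h (cmod z)) * ennreal (cmod (deriv f z) powr p) * indicator unit_disk z \<partial>lborel)"
proof -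
  have sets_area: "sets disk_area = sets (lebesgue_on unit_disk)"
    by (simp add: disk_area_def)
  \<comment> \<open>Measurability of \<open>h\<close> is known on [0,1) only, so its extension by
    zero is composed with \<open>cmod\<close>; on the disk this changes nothing.\<close>
  have "(\<lambda>x. indicator {0..<1} x *\<^sub>R h x) \<in> borel_measurable lebesgue"
    using h unfolding set_integrable_def by (rule borel_measurable_integrable)
  then have "(\<lambda>z::complex. indicator {0..<1} (cmod z) *\<^sub>R h (cmod z)) \<in> borel_measurable (lebesgue_on unit_disk)"
    by (intro measurable_restrict_space1 borel_measurable_lebesgue_radial)
  then have "(\<lambda>z. h (cmod z)) \<in> borel_measurable (lebesgue_on unit_disk)"
    by (rule measurable_cong[THEN iffD1, rotated]) (auto simp: indicator_def)
  then have hm: "(\<lambda>z. ennreal (h (cmod z))) \<in> borel_measurable disk_area"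
    unfolding measurable_cong_sets[OF sets_area refl] by measurable
  have "continuous_on unit_disk (deriv f)"
    using f by (auto simp: analytic_disk_def intro!: holomorphic_on_imp_continuous_on holomorphic_deriv)
  then have "(\<lambda>z. cmod (deriv f z)) \<in> borel_measurable (lebesgue_on unit_disk)"
    by (intro continuous_imp_measurable_on_sets_lebesgue continuous_on_norm) auto
  then have fm: "(\<lambda>z. ennreal (cmod (deriv f z) powr p)) \<in> borel_measurable disk_area"
    unfolding measurable_cong_sets[OF sets_area refl] by measurable
  show ?thesis
    unfolding dirichlet_int_def \<mu>
    using hm fm
    by (simp add: nn_integral_density) 
      (simp add: disk_area_def nn_integral_scale_measure nn_integral_restrict_space nn_integral_completion)
qed

text \<open>The pointwise bounds of \<open>radial_weight_bounds\<close> are integrated against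
  |f'|^p. The constants are theirs, with pi accounting for the normalization of area.\<close>

lemma dirichlet_int_comparable:
  fixes h :: "real \<Rightarrow> real"
  assumes p: "0 < p" and C: "0 < C"
    and h: "set_integrable lebesgue {0..<1} h"
    and h_aut: "\<And>\<sigma> z. \<sigma> \<in> disk_aut \<Longrightarrow> z \<in> unit_disk \<Longrightarrow>
      h (cmod (\<sigma> z)) \<le> C * h (cmod z) * cmod (deriv \<sigma> z) powr \<alpha>"
    and \<mu>: "\<mu> = density disk_area (\<lambda>z. ennreal (h (cmod z)))"
    and h0: "0 < h 0"
  obtains c1 c2 where "0 < c1" "0 < c2"
    "\<And>f. f \<in> analytic_disk \<Longrightarrow> bergman_int p \<alpha> (deriv f) \<le> ennreal c1 * dirichlet_int p \<mu> f"
    "\<And>f. f \<in> analytic_disk \<Longrightarrow> dirichlet_int p \<mu> f \<le> ennreal c2 * bergman_int p \<alpha> (deriv f)"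
proof
  show "0 < pi * C / h 0" "0 < C * h 0 / pi" using C h0 by auto
  fix f assume f: "f \<in> analytic_disk"
  note eq = dirichlet_int_eq[OF h \<mu> f less_imp_le[OF p]]
  have b1: "h (cmod z) * A \<le> C * h 0 * (A * (1 - (cmod z)\<^sup>2) powr \<alpha>)"
    and b2: "h 0 / C * (A * (1 - (cmod z)\<^sup>2) powr \<alpha>) \<le> h (cmod z) * A" if "z \<in> unit_disk" "0 \<le> A" for z A
    using mult_right_mono[OF radial_weight_bounds(1)[OF C h_aut that(1)] that(2)]
      mult_right_mono[OF radial_weight_bounds(2)[OF C h_aut that(1)] that(2)] C
    by (simp_all add: mult.commute mult.left_commute pos_divide_le_eq)
  define H where "H = (\<integral>\<^sup>+z. ennreal (h (cmod z)) * ennreal (cmod (deriv f z) powr p) * indicator unit_disk z \<partial>lborel)"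
  have "continuous_on unit_disk (deriv f)"
    using f by (auto simp: analytic_disk_def intro!: holomorphic_on_imp_continuous_on holomorphic_deriv)
  note m = bergman_integrand_measurable[OF this p, of \<alpha>]
  have c: "(\<integral>\<^sup>+z. ennreal c * (ennreal (cmod (deriv f z) powr p * (1 - (cmod z)\<^sup>2) powr \<alpha>) * indicator unit_disk z) \<partial>lborel)
    = ennreal c * bergman_int p \<alpha> (deriv f)" for c
    unfolding bergman_int_def using m by (intro nn_integral_cmult) simp
  have "H \<le> (\<integral>\<^sup>+z. ennreal (C * h 0) * (ennreal (cmod (deriv f z) powr p * (1 - (cmod z)\<^sup>2) powr \<alpha>) * indicator unit_disk z) \<partial>lborel)"
    unfolding H_def
  proof (rule nn_integral_mono)
    fix z show "ennreal (h (cmod z)) * ennreal (cmod (deriv f z) powr p) * indicator unit_disk z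
      \<le> ennreal (C * h 0) * (ennreal (cmod (deriv f z) powr p * (1 - (cmod z)\<^sup>2) powr \<alpha>) * indicator unit_disk z)"
      using ennreal_leI[OF b1[of z "cmod (deriv f z) powr p"]] C h0
      by (cases "z \<in> unit_disk") (simp_all only: ennreal_mult'' indicator_simps mult_1_right powr_ge_zero mult_nonneg_nonneg mult_zero_right order_refl if_True simp_thms)
  qed
  then have up: "H \<le> ennreal (C * h 0) * bergman_int p \<alpha> (deriv f)" by (simp add: c)
  show "dirichlet_int p \<mu> f \<le> ennreal (C * h 0 / pi) * bergman_int p \<alpha> (deriv f)"
    unfolding eq H_def[symmetric] using mult_left_mono[OF up, of "ennreal (1 / pi)"] C h0
    by (simp add: mult.assoc[symmetric] ennreal_mult'[symmetric])
  have "(\<integral>\<^sup>+z. ennreal (h 0 / C) * (ennreal (cmod (deriv f z) powr p * (1 - (cmod z)\<^sup>2) powr \<alpha>) * indicator unit_disk z) \<partial>lborel) \<le> H"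
    unfolding H_def
  proof (rule nn_integral_mono)
    fix z show "ennreal (h 0 / C) * (ennreal (cmod (deriv f z) powr p * (1 - (cmod z)\<^sup>2) powr \<alpha>) * indicator unit_disk z)
      \<le> ennreal (h (cmod z)) * ennreal (cmod (deriv f z) powr p) * indicator unit_disk z"
      using ennreal_leI[OF b2[of z "cmod (deriv f z) powr p"]] C h0
      by (cases "z \<in> unit_disk") (simp_all only: ennreal_mult'' indicator_simps mult_1_right powr_ge_zero mult_nonneg_nonneg mult_zero_right order_refl if_True simp_thms)
  qed
  then have "ennreal (h 0 / C) * bergman_int p \<alpha> (deriv f) \<le> H" by (simp add: c)
  then have "ennreal (C / h 0) * (ennreal (h 0 / C) * bergman_int p \<alpha> (deriv f)) \<le> ennreal (C / h 0) * H"
    by (rule mult_left_mono) simp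
  moreover have "ennreal (C / h 0) * (ennreal (h 0 / C) * bergman_int p \<alpha> (deriv f)) = bergman_int p \<alpha> (deriv f)"
    using C h0 by (simp add: mult.assoc[symmetric] ennreal_mult'[symmetric])
  moreover have "ennreal (pi * C / h 0) * dirichlet_int p \<mu> f = ennreal (C / h 0) * H"
    unfolding eq H_def[symmetric] using C h0
    by (simp add: mult.assoc[symmetric] ennreal_mult'[symmetric])
  ultimately show "bergman_int p \<alpha> (deriv f) \<le> ennreal (pi * C / h 0) * dirichlet_int p \<mu> f"
    by simp
qed

text \<open>If h(0) = 0, the upper bound for \<open>h\<close> makes it vanish on [0,1). Then z -> z
  has norm 0, which contradicts definiteness in the standing axiom.\<close>

lemma radial_weight_0_pos:
  fixes h :: "real \<Rightarrow> real"
  assumes p: "0 < p" and C: "0 < C"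
    and h_nonneg: "\<And>r. 0 \<le> r \<Longrightarrow> r < 1 \<Longrightarrow> 0 \<le> h r"
    and h: "set_integrable lebesgue {0..<1} h"
    and h_aut: "\<And>\<sigma> z. \<sigma> \<in> disk_aut \<Longrightarrow> z \<in> unit_disk \<Longrightarrow>
      h (cmod (\<sigma> z)) \<le> C * h (cmod z) * cmod (deriv \<sigma> z) powr \<alpha>"
    and \<mu>: "\<mu> = density disk_area (\<lambda>z. ennreal (h (cmod z)))"
    and axiom_D: "standing_axiom p \<mu>"
  shows "0 < h 0"
proof (rule ccontr)
  assume "\<not> 0 < h 0"
  then have "h 0 = 0" using h_nonneg[of 0] by simp
  then have h0: "h (cmod z) \<le> 0" if "z \<in> unit_disk" for z
    using radial_weight_bounds(1)[OF C h_aut that] by simp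
  have id: "(\<lambda>z. z) \<in> analytic_disk" by (simp add: analytic_disk_def)
  have "(\<integral>\<^sup>+z. ennreal (h (cmod z)) * ennreal (cmod (deriv (\<lambda>z. z) z) powr p) * indicator unit_disk z \<partial>lborel) = (\<integral>\<^sup>+z. 0 \<partial>(lborel :: complex measure))"
    by (intro nn_integral_cong) (auto split: split_indicator simp: ennreal_neg h0)
  then have "dirichlet_int p \<mu> (\<lambda>z. z) = 0"
    using dirichlet_int_eq[OF h \<mu> id less_imp_le[OF p]] by simp
  then have "D_norm p \<mu> (\<lambda>z. z) = 0" using p by (simp add: D_norm_def ennroot_def)
  moreover from this have "(\<lambda>z. z) \<in> D_space p \<mu>" using id by (simp add: D_space_def)
  moreover have "\<forall>f\<in>D_space p \<mu>. D_norm p \<mu> f < \<infinity> \<and> (D_norm p \<mu> f = 0 \<longleftrightarrow> (\<forall>z\<in>unit_disk. f z = 0))"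
    using axiom_D unfolding standing_axiom_def banach_function_space_def by (elim conjE)
  ultimately have "\<forall>z\<in>unit_disk. z = 0" by (metis (no_types, lifting))
  then have "(1/2::complex) = 0" by (rule bspec) simp
  then show False by simp
qed

subsection \<open>Dilations as Poisson averages of rotations\<close>

text \<open>On [0,1] this is the parametrization of \<open>circlepath 0 1\<close>, so that dt is
  normalized arc length.\<close>

abbreviation circ :: "real \<Rightarrow> complex" where
  "circ t \<equiv> exp (2 * of_real pi * \<i> * of_real t)"

text \<open>The Poisson kernel at the real point r alone: r is the dilation factor, and the boundary
  point \<open>\<zeta>\<close> is the rotation it is averaged over.\<close>

definition poisson :: "real \<Rightarrow> complex \<Rightarrow> real" where
  "poisson r \<zeta> = (1 - r\<^sup>2) / (cmod (\<zeta> - of_real r))\<^sup>2"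

lemma norm_circ [simp]: "cmod (circ t) = 1"
  by (simp add: norm_exp_eq_Re)

lemma poisson_nonneg: "0 \<le> r \<Longrightarrow> r < 1 \<Longrightarrow> 0 \<le> poisson r \<zeta>"
  by (simp add: poisson_def power_le_one)

lemma continuous_on_circ: "continuous_on A circ"
  by (intro continuous_intros)

lemma continuous_on_poisson_circ:
  assumes "0 \<le> r" "r < 1"
  shows "continuous_on A (\<lambda>t. poisson r (circ t))"
proof -
  have "cmod (circ t - of_real r) \<noteq> 0" for t
  proof
    assume "cmod (circ t - of_real r) = 0"
    then have "cmod (circ t) = cmod (of_real r)" by simp
    then show False using assms by simp
  qed
  then show ?thesis unfolding poisson_def
    by (intro continuous_on_divide continuous_on_power continuous_on_norm continuous_on_diff continuous_on_circ
        continuous_on_const) auto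
qed

text \<open>Cauchy's formula at r minus Cauchy's theorem for the pole at the reflected point 1/r. On
  the circle the difference of the two kernels is the Poisson kernel.\<close>

lemma poisson_integral_formula:
  assumes F: "F holomorphic_on ball 0 R" and R: "1 < R" and r: "0 < r" "r < 1"
  shows "((\<lambda>t. of_real (poisson r (circ t)) * F (circ t)) has_integral F (of_real r)) {0..1}"
proof -
  \<comment> \<open>A disk of radius S > 1 on which F is holomorphic and which avoids the pole
    1/r.\<close>
  define S where "S = min R (1 / r)"
  have S: "1 < S" "S \<le> R" "S \<le> 1 / r" using R r by (auto simp: S_def)
  have sub: "cball 0 1 \<subseteq> ball (0::complex) R" using R by auto
  have "((\<lambda>u. F u / (u - of_real r)) has_contour_integral (2 * of_real pi * \<i> * F (of_real r))) (circlepath 0 1)"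
    using r R by (intro Cauchy_integral_circlepath holomorphic_on_imp_continuous_on holomorphic_on_subset[OF F]) auto
  moreover have "((\<lambda>u. F u / (u - of_real (1 / r))) has_contour_integral 0) (circlepath 0 1)"
  proof (rule Cauchy_theorem_disc_simple[of _ 0 S])
    have "u \<noteq> of_real (1 / r)" if "u \<in> ball 0 S" for u :: complex
    proof
      assume "u = of_real (1 / r)"
      then have "cmod u = 1 / r" using r by (simp add: norm_divide)
      then show False using that S by simp
    qed
    then show "(\<lambda>u. F u / (u - of_real (1 / r))) holomorphic_on ball 0 S"
      using S by (intro holomorphic_intros holomorphic_on_subset[OF F]) auto
  qed (use S in auto)
  ultimately have "((\<lambda>u. F u / (u - of_real r) - F u / (u - of_real (1 / r)))
      has_contour_integral (2 * of_real pi * \<i> * F (of_real r) - 0)) (circlepath 0 1)"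
    by (rule has_contour_integral_diff)
  then have "((\<lambda>t. (F (circ t) / (circ t - of_real r) - F (circ t) / (circ t - of_real (1 / r)))
      * (2 * pi * \<i> * circ t)) has_integral (2 * of_real pi * \<i> * F (of_real r))) {0..1}"
    unfolding has_contour_integral vector_derivative_circlepath by (simp add: circlepath)
  then have "((\<lambda>t. 1 / (2 * of_real pi * \<i>) * ((F (circ t) / (circ t - of_real r) - F (circ t) / (circ t - of_real (1 / r)))
      * (2 * pi * \<i> * circ t))) has_integral 1 / (2 * of_real pi * \<i>) * (2 * of_real pi * \<i> * F (of_real r))) {0..1}"
    by (rule has_integral_mult_right)
  moreover have "1 / (2 * of_real pi * \<i>) * ((F u / (u - of_real r) - F u / (u - of_real (1 / r)))
      * (2 * pi * \<i> * u)) = of_real (poisson r u) * F u" if u: "cmod u = 1" for u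
  proof -
    have nz: "u \<noteq> 0" "u - of_real r \<noteq> 0" "u - of_real (1 / r) \<noteq> 0" "1 - of_real r * u \<noteq> 0"
      using u r by (auto simp: norm_divide dest!: arg_cong[of _ _ cmod] simp: norm_mult)
    \<comment> \<open>This makes |u - r|^2 a rational function of u on the circle.\<close>
    have "cnj u = 1 / u" using nz(1) u complex_norm_square[of u] by (simp add: field_simps)
    then have "complex_of_real ((cmod (u - of_real r))\<^sup>2) = (u - of_real r) * (1 / u - of_real r)"
      by (simp only: complex_norm_square complex_cnj_diff complex_cnj_complex_of_real)
    also have "\<dots> = (u - of_real r) * (1 - of_real r * u) / u" using nz by (simp add: field_simps)
    finally have P: "of_real (poisson r u) = (1 - (of_real r)\<^sup>2) * u / ((u - of_real r) * (1 - of_real r * u))"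
      unfolding poisson_def of_real_divide by simp
    define y where "y = 1 - of_real r * u"
    have "u - of_real (1 / r) = - (y / of_real r)" using r by (simp add: y_def field_simps)
    then have "(1 / (u - of_real r) - 1 / (u - of_real (1 / r))) * u
       = (1 / (u - of_real r) + of_real r / (1 - of_real r * u)) * u"
      by (simp flip: y_def)
    also have "\<dots> = (1 - (of_real r)\<^sup>2) * u / ((u - of_real r) * (1 - of_real r * u))"
      using nz by (simp add: divide_simps) (simp add: algebra_simps power2_eq_square)
    finally have *: "(1 / (u - of_real r) - 1 / (u - of_real (1 / r))) * u = of_real (poisson r u)" by (simp add: P)
    have "1 / (2 * of_real pi * \<i>) * ((F u / (u - of_real r) - F u / (u - of_real (1 / r))) * (2 * pi * \<i> * u))
      = (1 / (u - of_real r) - 1 / (u - of_real (1 / r))) * u * F u"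
      by (simp add: algebra_simps)
    then show ?thesis by (simp only: *)
  qed
  ultimately show ?thesis by simp
qed

lemma poisson_integral_1:
  assumes "0 < r" "r < 1"
  shows "((\<lambda>t. poisson r (circ t)) has_integral 1) {0..1}"
proof -
  have "((\<lambda>t. of_real (poisson r (circ t)) * 1) has_integral (1::complex)) {0..1}"
    using poisson_integral_formula[of "\<lambda>_. 1" 2 r] assms by simp
  then show ?thesis
    using has_integral_linear[OF _ bounded_linear_Re] by (force simp: o_def)
qed

text \<open>Convexity of y^p for y > 0. At y = 0 the claim reads (1 - p) c^p <= 0.\<close>

lemma powr_above_tangent:
  fixes y c p :: real
  assumes "1 \<le> p" "0 \<le> y" "0 < c"
  shows "c powr p + p * c powr (p - 1) * (y - c) \<le> y powr p"
proof (cases "y = 0")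
  case True
  have "c powr p = c powr (p - 1) * c" using assms by (simp add: powr_diff)
  then show ?thesis using assms True by (simp add: algebra_simps) 
next
  case False
  have "y powr p - c powr p \<ge> (p * c powr (p - 1)) * (y - c)"
    by (rule convex_on_imp_above_tangent[OF powr_convex[OF assms(1)]])
      (use assms False in \<open>auto intro!: derivative_eq_intros simp: interior_open\<close>)
  then show ?thesis by simp
qed

text \<open>Jensen's inequality for the probability density \<open>k\<close>: the tangent inequality
  at the mean \<open>c\<close> of |G| is multiplied by \<open>k\<close> and integrated. The case c =
  0 is separate, since the tangent is taken at a positive point.\<close>

lemma jensen_powr_norm:
  fixes k :: "real \<Rightarrow> real" and G :: "real \<Rightarrow> complex"
  assumes p: "1 \<le> p" and k: "continuous_on {0..1} k" "\<And>t. 0 \<le> k t" "(k has_integral 1) {0..1}"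
    and G: "continuous_on {0..1} G" and I: "((\<lambda>t. of_real (k t) * G t) has_integral v) {0..1}"
  shows "ennreal (cmod v powr p) \<le> (\<integral>\<^sup>+t\<in>{0..1}. ennreal (k t * cmod (G t) powr p) \<partial>lborel)"
proof -
  have cp: "continuous_on {0..1} (\<lambda>t. cmod (G t) powr p)"
    using p by (intro continuous_on_powr'[OF continuous_on_norm[OF G] continuous_on_const]) simp
  have i1: "(\<lambda>t. k t * cmod (G t)) integrable_on {0..1}"
    by (intro integrable_continuous_real continuous_on_mult k continuous_on_norm G)
  have i2: "(\<lambda>t. k t * cmod (G t) powr p) integrable_on {0..1}"
    by (intro integrable_continuous_real continuous_on_mult k cp)
  define c where "c = integral {0..1} (\<lambda>t. k t * cmod (G t))"
  define d where "d = integral {0..1} (\<lambda>t. k t * cmod (G t) powr p)"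
  have vc: "cmod v \<le> c"
    unfolding integral_unique[OF I, symmetric] c_def
    by (rule integral_norm_bound_integral) (use I i1 k in \<open>auto simp: norm_mult abs_of_nonneg\<close>)
  have d0: "0 \<le> d" unfolding d_def by (rule integral_nonneg[OF i2]) (use k in auto)
  have "c powr p \<le> d"
  proof (cases "c > 0")
    case True
    \<comment> \<open>A + B y is the tangent of y^p at \<open>c\<close>. Since \<open>k\<close> has
      integral 1, integration turns it into A + B c = c^p.\<close>
    define A where "A = c powr p - p * c powr (p - 1) * c"
    define B where "B = p * c powr (p - 1)"
    have "((\<lambda>t. A * k t + B * (k t * cmod (G t))) has_integral (A * 1 + B * c)) {0..1}"
      unfolding c_def by (intro has_integral_add has_integral_mult_right k integrable_integral i1)
    then have "A * 1 + B * c \<le> d"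
      unfolding d_def
    proof (rule has_integral_le[OF _ integrable_integral[OF i2]])
      fix t
      have "k t * (c powr p + p * c powr (p - 1) * (cmod (G t) - c)) \<le> k t * cmod (G t) powr p"
        by (intro mult_left_mono powr_above_tangent p True k) auto
      then show "A * k t + B * (k t * cmod (G t)) \<le> k t * cmod (G t) powr p"
        by (simp add: A_def B_def algebra_simps)
    qed
    then show ?thesis by (simp add: A_def B_def)
  next
    case False
    then have "c = 0" using vc norm_ge_zero[of v] by linarith
    then show ?thesis using d0 p by simp
  qed
  moreover have "cmod v powr p \<le> c powr p" using vc p by (intro powr_mono2) auto
  ultimately have "ennreal (cmod v powr p) \<le> ennreal d" by (intro ennreal_leI) simp
  also have "\<dots> = (\<integral>\<^sup>+t. ennreal (indicator {0..1} t * (k t * cmod (G t) powr p)) \<partial>lborel)"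
    using nn_integral_has_integral_lebesgue[OF _ integrable_integral[OF i2]] k by (simp add: d_def)
  also have "\<dots> = (\<integral>\<^sup>+t\<in>{0..1}. ennreal (k t * cmod (G t) powr p) \<partial>lborel)"
    by (intro nn_integral_cong) (auto split: split_indicator)
  finally show ?thesis .
qed

text \<open>One formula covers rotations and dilations. Its right side is holomorphic in
  \<open>\<zeta>\<close> past the closed unit disk, which allows the Poisson formula in
  \<open>\<zeta>\<close>.\<close>

lemma deriv_comp_dilation_diff:
  assumes f: "f \<in> analytic_disk" and \<sigma>: "\<sigma> \<in> disk_aut" and \<zeta>: "cmod \<zeta> \<le> 1" and z: "z \<in> unit_disk"
  shows "deriv (\<lambda>z. f (\<sigma> z) - f (\<zeta> * \<sigma> z)) z = (deriv f (\<sigma> z) - \<zeta> * deriv f (\<zeta> * \<sigma> z)) * deriv \<sigma> z"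
proof -
  have w: "cmod (\<sigma> z) < 1" using disk_aut_mem[OF \<sigma> z] by simp
  have w': "cmod (\<zeta> * \<sigma> z) < 1"
    using mult_right_mono[OF \<zeta>, of "cmod (\<sigma> z)"] w by (simp add: norm_mult)
  have d: "(f has_field_derivative deriv f u) (at u)" if "cmod u < 1" for u
    using f that by (intro holomorphic_derivI[of f unit_disk]) (auto simp: analytic_disk_def)
  have s: "(\<sigma> has_field_derivative deriv \<sigma> z) (at z)"
    using \<sigma> z by (intro holomorphic_derivI[of \<sigma> unit_disk]) (auto simp: disk_aut_def)
  have "((\<lambda>z. f (\<sigma> z)) has_field_derivative deriv f (\<sigma> z) * deriv \<sigma> z) (at z)"
    by (rule DERIV_chain2[OF d[OF w] s])
  moreover have "((\<lambda>z. f (\<zeta> * \<sigma> z)) has_field_derivative deriv f (\<zeta> * \<sigma> z) * (\<zeta> * deriv \<sigma> z)) (at z)"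
    by (rule DERIV_chain2[OF d[OF w'] DERIV_cmult[OF s]])
  ultimately have "((\<lambda>z. f (\<sigma> z) - f (\<zeta> * \<sigma> z)) has_field_derivative
      deriv f (\<sigma> z) * deriv \<sigma> z - deriv f (\<zeta> * \<sigma> z) * (\<zeta> * deriv \<sigma> z)) (at z)"
    by (rule DERIV_diff)
  then show ?thesis by (subst DERIV_imp_deriv) (auto simp: algebra_simps)
qed

text \<open>For fixed z the Poisson formula in \<zeta> expresses \<open>H (of_real r) z\<close> as
  an average of the values \<open>H (circ t) z\<close>. Jensen gives the bound pointwise in z, and
  Tonelli exchanges the integrals over z and t.\<close>

lemma bergman_int_dilation_le:
  assumes f: "f \<in> analytic_disk" and \<sigma>: "\<sigma> \<in> disk_aut" and r: "0 < r" "r < 1" and p: "1 \<le> p"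
  shows "bergman_int p \<alpha> (deriv (\<lambda>z. f (\<sigma> z) - f (of_real r * \<sigma> z)))
    \<le> (\<integral>\<^sup>+t\<in>{0..1}. ennreal (poisson r (circ t)) * bergman_int p \<alpha> (deriv (\<lambda>z. f (\<sigma> z) - f (circ t * \<sigma> z))) \<partial>lborel)"
proof -
  define H where "H \<zeta> z = (deriv f (\<sigma> z) - \<zeta> * deriv f (\<zeta> * \<sigma> z)) * deriv \<sigma> z" for \<zeta> z
  define w where "w z = (1 - (cmod z)\<^sup>2) powr \<alpha>" for z :: complex
  note nn = poisson_nonneg[OF less_imp_le[OF r(1)] r(2)]
  have f': "deriv f holomorphic_on unit_disk"
    using f by (auto simp: analytic_disk_def intro: holomorphic_deriv)
  have \<sigma>': "continuous_on unit_disk \<sigma>" "continuous_on unit_disk (deriv \<sigma>)"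
    using \<sigma> by (auto simp: disk_aut_def intro: holomorphic_on_imp_continuous_on holomorphic_deriv)
  have pt: "ennreal (cmod (H (of_real r) z) powr p) \<le>
      (\<integral>\<^sup>+t\<in>{0..1}. ennreal (poisson r (circ t) * cmod (H (circ t) z) powr p) \<partial>lborel)" if z: "z \<in> unit_disk" for z
  proof -
    have sz: "cmod (\<sigma> z) < 1" using disk_aut_mem[OF \<sigma> z] by simp
    \<comment> \<open>Chosen so that R > 1 and R |sigma(z)| < 1, hence
      \<open>deriv f (\<zeta> * \<sigma> z)\<close> is holomorphic for |\<zeta>| < R.\<close>
    define R where "R = 2 / (1 + cmod (\<sigma> z))"
    have R: "1 < R" using sz by (simp add: R_def less_divide_eq add_pos_nonneg)
    have "\<zeta> * \<sigma> z \<in> unit_disk" if "\<zeta> \<in> ball 0 R" for \<zeta>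
    proof -
      have "cmod \<zeta> * cmod (\<sigma> z) \<le> R * cmod (\<sigma> z)" using that by (intro mult_right_mono) auto
      also have "\<dots> < 1" using sz by (simp add: R_def divide_less_eq add_pos_nonneg)
      finally show ?thesis by (simp add: norm_mult)
    qed
    then have hol: "(\<lambda>\<zeta>. H \<zeta> z) holomorphic_on ball 0 R"
      unfolding H_def
      by (intro holomorphic_intros holomorphic_on_compose_gen[OF _ f', unfolded o_def]) auto
    have "continuous_on {0..1} (\<lambda>t. H (circ t) z)"
      using R by (intro continuous_on_compose2[OF holomorphic_on_imp_continuous_on[OF hol] continuous_on_circ]) auto
    then show ?thesis
      using nn poisson_integral_formula[OF hol R r] poisson_integral_1[OF r] r
      by (intro jensen_powr_norm[OF p] continuous_on_poisson_circ) auto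
  qed
  have jc: "continuous_on (unit_disk \<times> {0..1}) (\<lambda>x. poisson r (circ (snd x)) * (cmod (H (circ (snd x)) (fst x)) powr p * w (fst x)))"
  proof -
    have 1: "continuous_on (unit_disk \<times> {0..1}) (\<lambda>x::complex\<times>real. poisson r (circ (snd x)))"
      by (intro continuous_on_compose2[OF continuous_on_poisson_circ[of r UNIV] continuous_on_snd[OF continuous_on_id]]) (use r in auto)
    have 2: "continuous_on (unit_disk \<times> {0..1}) (\<lambda>x::complex\<times>real. circ (snd x))"
      by (intro continuous_on_compose2[OF continuous_on_circ[of UNIV] continuous_on_snd[OF continuous_on_id]]) auto
    have 3: "continuous_on (unit_disk \<times> {0..1}) (\<lambda>x::complex\<times>real. \<sigma> (fst x))"
      by (intro continuous_on_compose2[OF \<sigma>'(1) continuous_on_fst[OF continuous_on_id]]) auto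
    have 4: "continuous_on (unit_disk \<times> {0..1}) (\<lambda>x::complex\<times>real. deriv \<sigma> (fst x))"
      by (intro continuous_on_compose2[OF \<sigma>'(2) continuous_on_fst[OF continuous_on_id]]) auto
    note f'c = holomorphic_on_imp_continuous_on[OF f']
    have 5: "continuous_on (unit_disk \<times> {0..1}) (\<lambda>x::complex\<times>real. deriv f (\<sigma> (fst x)))"
      using disk_aut_mem[OF \<sigma>] by (intro continuous_on_compose2[OF f'c 3]) auto
    have 6: "continuous_on (unit_disk \<times> {0..1}) (\<lambda>x::complex\<times>real. deriv f (circ (snd x) * \<sigma> (fst x)))"
      using disk_aut_mem[OF \<sigma>] by (intro continuous_on_compose2[OF f'c continuous_on_mult[OF 2 3]]) (auto simp: norm_mult)
    have 7: "continuous_on (unit_disk \<times> {0..1}) (\<lambda>x::complex\<times>real. H (circ (snd x)) (fst x))"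
      unfolding H_def by (intro continuous_on_mult continuous_on_diff 2 4 5 6)
    have 8: "continuous_on (unit_disk \<times> {0..1}) (\<lambda>x::complex\<times>real. cmod (H (circ (snd x)) (fst x)) powr p)"
      using p by (intro continuous_on_powr'[OF continuous_on_norm[OF 7] continuous_on_const]) simp
    have "continuous_on unit_disk w"
      unfolding w_def
    proof (intro continuous_on_powr continuous_intros ballI)
      fix z :: complex assume "z \<in> unit_disk"
      then have "(cmod z)\<^sup>2 < 1" by (simp add: abs_square_less_1)
      then show "1 - (cmod z)\<^sup>2 \<noteq> 0" by linarith
    qed
    then have 9: "continuous_on (unit_disk \<times> {0..1}) (\<lambda>x::complex\<times>real. w (fst x))"
      by (rule continuous_on_compose2[OF _ continuous_on_fst[OF continuous_on_id]]) auto
    show ?thesis by (intro continuous_on_mult 1 8 9)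
  qed
  \<comment> \<open>The joint integrand, extended by zero. It is Borel on the product because
    \<open>jc\<close> gives joint continuity on the disk times [0,1].\<close>
  define \<Phi> where "\<Phi> z t = ennreal (poisson r (circ t) * (cmod (H (circ t) z) powr p * w z)) * indicator unit_disk z * indicator {0..1} t" for z t
  have \<Phi>m: "case_prod \<Phi> \<in> borel_measurable (lborel \<Otimes>\<^sub>M lborel)"
  proof -
    have "unit_disk \<times> {0..1::real} \<in> sets borel"
      by (intro borel_Times) auto
    note borel_measurable_ennreal_indicator[OF this jc]
    also have "(\<lambda>x. ennreal (poisson r (circ (snd x)) * (cmod (H (circ (snd x)) (fst x)) powr p * w (fst x))) * indicator (unit_disk \<times> {0..1}) x)
       = case_prod \<Phi>"
      by (auto simp: \<Phi>_def fun_eq_iff split: split_indicator)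
    finally show ?thesis by (simp add: lborel_prod)
  qed
  have "bergman_int p \<alpha> (deriv (\<lambda>z. f (\<sigma> z) - f (of_real r * \<sigma> z))) = bergman_int p \<alpha> (H (of_real r))"
    using r by (intro bergman_int_cong) (auto simp: H_def deriv_comp_dilation_diff[OF f \<sigma>])
  also have "\<dots> \<le> (\<integral>\<^sup>+z. (\<integral>\<^sup>+t. \<Phi> z t \<partial>lborel) \<partial>lborel)"
    unfolding bergman_int_def
  proof (rule nn_integral_mono)
    fix z :: complex
    show "ennreal (cmod (H (of_real r) z) powr p * (1 - (cmod z)\<^sup>2) powr \<alpha>) * indicator unit_disk z \<le> (\<integral>\<^sup>+t. \<Phi> z t \<partial>lborel)"
    proof (cases "z \<in> unit_disk")
      case True
      have mt: "(\<lambda>t. ennreal (poisson r (circ t) * cmod (H (circ t) z) powr p) * indicator {0..1} t) \<in> borel_measurable lborel"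
      proof -
        have 1: "continuous_on {0..1} (\<lambda>t. deriv f (circ t * \<sigma> z))"
          using disk_aut_mem[OF \<sigma> True]
          by (intro continuous_on_compose2[OF holomorphic_on_imp_continuous_on[OF f']] continuous_intros) (auto simp: norm_mult)
        have 2: "continuous_on {0..1} (\<lambda>t. H (circ t) z)"
          unfolding H_def by (intro continuous_on_mult continuous_on_diff 1 continuous_on_circ continuous_on_const)
        have "continuous_on {0..1} (\<lambda>t. poisson r (circ t) * cmod (H (circ t) z) powr p)"
          using p r by (intro continuous_on_mult continuous_on_poisson_circ continuous_on_powr'[OF continuous_on_norm[OF 2] continuous_on_const]) auto
        then show ?thesis using borel_measurable_ennreal_indicator[of "{0..1::real}"] by simp
      qed
      have "ennreal (cmod (H (of_real r) z) powr p * w z) = ennreal (w z) * ennreal (cmod (H (of_real r) z) powr p)"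
        by (simp add: ennreal_mult' w_def mult.commute)
      also have "\<dots> \<le> ennreal (w z) * (\<integral>\<^sup>+t\<in>{0..1}. ennreal (poisson r (circ t) * cmod (H (circ t) z) powr p) \<partial>lborel)"
        by (intro mult_left_mono pt[OF True]) simp
      also have "\<dots> = (\<integral>\<^sup>+t. ennreal (w z) * (ennreal (poisson r (circ t) * cmod (H (circ t) z) powr p) * indicator {0..1} t) \<partial>lborel)"
        using mt by (intro nn_integral_cmult[symmetric]) simp
      also have "\<dots> = (\<integral>\<^sup>+t. \<Phi> z t \<partial>lborel)"
        using True nn by (intro nn_integral_cong) (auto simp: \<Phi>_def w_def ennreal_mult mult_ac split: split_indicator)
      finally show ?thesis using True by (simp add: w_def)
    qed simp
  qed
  also have "\<dots> = (\<integral>\<^sup>+t. (\<integral>\<^sup>+z. \<Phi> z t \<partial>lborel) \<partial>lborel)"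
    by (rule lborel_pair.Fubini'[OF \<Phi>m, symmetric])
  also have "\<dots> = (\<integral>\<^sup>+t\<in>{0..1}. ennreal (poisson r (circ t)) * bergman_int p \<alpha> (deriv (\<lambda>z. f (\<sigma> z) - f (circ t * \<sigma> z))) \<partial>lborel)"
  proof (rule nn_integral_cong)
    fix t :: real
    have "continuous_on unit_disk (\<lambda>z. deriv f (circ t * \<sigma> z))" 
      using disk_aut_mem[OF \<sigma>]
      by (intro continuous_on_compose2[OF holomorphic_on_imp_continuous_on[OF f'] continuous_on_mult[OF continuous_on_const \<sigma>'(1)]]) (auto simp: norm_mult)
    moreover have "continuous_on unit_disk (\<lambda>z. deriv f (\<sigma> z))" 
      using disk_aut_mem[OF \<sigma>]
      by (intro continuous_on_compose2[OF holomorphic_on_imp_continuous_on[OF f'] \<sigma>'(1)]) auto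
    ultimately have "continuous_on unit_disk (H (circ t))"
      unfolding H_def by (intro continuous_on_mult continuous_on_diff continuous_on_const \<sigma>')
    note mz = bergman_integrand_measurable[OF this, of p \<alpha>]
    have "(\<integral>\<^sup>+z. \<Phi> z t \<partial>lborel) = (\<integral>\<^sup>+z. ennreal (poisson r (circ t)) * indicator {0..1} t * (ennreal (cmod (H (circ t) z) powr p * (1 - (cmod z)\<^sup>2) powr \<alpha>) * indicator unit_disk z) \<partial>lborel)"
      using nn by (intro nn_integral_cong) (auto simp: \<Phi>_def w_def ennreal_mult mult_ac split: split_indicator)
    also have "\<dots> = ennreal (poisson r (circ t)) * indicator {0..1} t * bergman_int p \<alpha> (H (circ t))"
      unfolding bergman_int_def using mz p by (intro nn_integral_cmult) simp
    also have "bergman_int p \<alpha> (H (circ t)) = bergman_int p \<alpha> (deriv (\<lambda>z. f (\<sigma> z) - f (circ t * \<sigma> z)))"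
      by (intro bergman_int_cong) (auto simp: H_def deriv_comp_dilation_diff[OF f \<sigma>])
    finally show "(\<integral>\<^sup>+z. \<Phi> z t \<partial>lborel) = ennreal (poisson r (circ t)) * bergman_int p \<alpha> (deriv (\<lambda>z. f (\<sigma> z) - f (circ t * \<sigma> z))) * indicator {0..1} t"
      by (simp add: mult_ac)
  qed
  finally show ?thesis .
qed

subsection \<open>Uniform approximation by rotations and dilations\<close>

lemma bergman_weight_le_1: "0 \<le> \<alpha> \<Longrightarrow> z \<in> unit_disk \<Longrightarrow> (1 - (cmod z)\<^sup>2) powr \<alpha> \<le> 1"
  by (rule powr_le1) (auto simp: power_le_one)

text \<open>With L = (1 + \<rho>)/(1 - \<rho>), the factor |sigma'|^p contributes L^p, replacing the
  weight at z by the one at sigma(z) contributes L^\<alpha>, and the change of area contributes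
  L^2.\<close>

lemma bergman_int_comp_le:
  assumes \<sigma>: "\<sigma> \<in> disk_aut" and \<rho>: "cmod (\<sigma> 0) \<le> \<rho>" "\<rho> < 1"
    and g: "continuous_on unit_disk g" and p: "0 < p" and \<alpha>: "0 \<le> \<alpha>"
  shows "bergman_int p \<alpha> (\<lambda>z. g (\<sigma> z) * deriv \<sigma> z)
    \<le> ennreal (((1 + \<rho>) / (1 - \<rho>)) powr (p + \<alpha>) * ((1 + \<rho>) / (1 - \<rho>))\<^sup>2) * bergman_int p \<alpha> g"
proof -
  define L where "L = (1 + \<rho>) / (1 - \<rho>)"
  have "0 \<le> \<rho>" using \<rho> norm_ge_zero[of "\<sigma> 0"] by linarith
  then have L: "0 < L" using \<rho> by (simp add: L_def)
  define G where "G w = ennreal (cmod (g w) powr p * (1 - (cmod w)\<^sup>2) powr \<alpha>) * indicator unit_disk w" for w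
  have G: "G \<in> borel_measurable borel"
    unfolding G_def by (rule bergman_integrand_measurable[OF g p])
  have bG: "bergman_int p \<alpha> g = (\<integral>\<^sup>+z. G z \<partial>lborel)" unfolding bergman_int_def G_def ..
  have "bergman_int p \<alpha> (\<lambda>z. g (\<sigma> z) * deriv \<sigma> z) \<le> (\<integral>\<^sup>+z\<in>unit_disk. ennreal (L powr (p + \<alpha>)) * G (\<sigma> z) \<partial>lborel)"
    unfolding bergman_int_def
  proof (rule nn_integral_mono)
    fix z
    show "ennreal (cmod (g (\<sigma> z) * deriv \<sigma> z) powr p * (1 - (cmod z)\<^sup>2) powr \<alpha>) * indicator unit_disk z
      \<le> ennreal (L powr (p + \<alpha>)) * G (\<sigma> z) * indicator unit_disk z"
    proof (cases "z \<in> unit_disk")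
      case True
      note b = disk_aut_deriv_bounds[OF \<sigma> \<rho> True, folded L_def]
      have sz: "\<sigma> z \<in> unit_disk" by (rule disk_aut_mem[OF \<sigma> True])
      have "cmod (g (\<sigma> z) * deriv \<sigma> z) powr p * (1 - (cmod z)\<^sup>2) powr \<alpha>
         = cmod (g (\<sigma> z)) powr p * (cmod (deriv \<sigma> z) powr p * (1 - (cmod z)\<^sup>2) powr \<alpha>)"
        by (simp add: norm_mult powr_mult)
      also have "\<dots> \<le> cmod (g (\<sigma> z)) powr p * (L powr p * (L * (1 - (cmod (\<sigma> z))\<^sup>2)) powr \<alpha>)"
        using b True p \<alpha> by (intro mult_left_mono mult_mono powr_mono2) (auto simp: power_le_one)
      also have "\<dots> = L powr (p + \<alpha>) * (cmod (g (\<sigma> z)) powr p * (1 - (cmod (\<sigma> z))\<^sup>2) powr \<alpha>)"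
        using L sz by (simp add: powr_mult powr_add power_le_one)
      finally have "ennreal (cmod (g (\<sigma> z) * deriv \<sigma> z) powr p * (1 - (cmod z)\<^sup>2) powr \<alpha>)
        \<le> ennreal (L powr (p + \<alpha>) * (cmod (g (\<sigma> z)) powr p * (1 - (cmod (\<sigma> z))\<^sup>2) powr \<alpha>))"
        by (rule ennreal_leI)
      then show ?thesis using True sz by (simp add: G_def ennreal_mult)
    qed simp
  qed
  also have "\<dots> \<le> ennreal (L\<^sup>2) * (\<integral>\<^sup>+z\<in>unit_disk. ennreal (L powr (p + \<alpha>)) * G z \<partial>lborel)"
    unfolding L_def using G by (intro nn_integral_disk_aut_le[OF \<sigma> \<rho>]) measurable
  also have "(\<integral>\<^sup>+z\<in>unit_disk. ennreal (L powr (p + \<alpha>)) * G z \<partial>lborel) = (\<integral>\<^sup>+z. ennreal (L powr (p + \<alpha>)) * G z \<partial>lborel)"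
    by (intro nn_integral_cong) (auto simp: G_def split: split_indicator)
  also have "\<dots> = ennreal (L powr (p + \<alpha>)) * bergman_int p \<alpha> g"
    using G bG by (subst nn_integral_cmult) simp_all
  finally show ?thesis
    by (simp add: L_def[symmetric] ennreal_mult mult_ac)
qed

text \<open>Continuity from above of the finite measure with density \<open>G\<close>: the sets
  \<open>A n\<close> decrease and no point of the disk lies in all of them.\<close>

lemma bergman_int_tail:
  assumes g: "continuous_on unit_disk g" and p: "0 < p" and fin: "bergman_int p \<alpha> g < \<infinity>" and \<epsilon>: "0 < \<epsilon>"
  obtains R where "0 < R" "R < 1"
    "(\<integral>\<^sup>+z\<in>unit_disk. ennreal (cmod (g z) powr p * (1 - (cmod z)\<^sup>2) powr \<alpha>) * indicator {z. R < cmod z} z \<partial>lborel) < ennreal \<epsilon>"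
proof -
  define G where "G w = ennreal (cmod (g w) powr p * (1 - (cmod w)\<^sup>2) powr \<alpha>) * indicator unit_disk w" for w
  have G: "G \<in> borel_measurable lborel"
    unfolding G_def using bergman_integrand_measurable[OF g p] by simp
  \<comment> \<open>The shift by 2 keeps every radius at least 1/2, so that the radius obtained is
    positive.\<close>
  define A where "A n = {z::complex. 1 - 1 / real (n + 2) < cmod z}" for n
  have A: "A n \<in> sets lborel" for n
    unfolding A_def by (simp add: open_Collect_less continuous_intros borel_open)
  have eA: "emeasure (density lborel G) (A n) = (\<integral>\<^sup>+z. G z * indicator (A n) z \<partial>lborel)" for n
    using A G by (intro emeasure_density)
  have "(\<lambda>n. emeasure (density lborel G) (A n)) \<longlonglongrightarrow> emeasure (density lborel G) (\<Inter>n. A n)"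
  proof (rule Lim_emeasure_decseq)
    show "decseq A"
    proof (rule decseq_SucI)
      show "A (Suc n) \<subseteq> A n" for n
        by (auto simp: A_def elim!: le_less_trans[rotated] intro!: frac_le)
    qed
    show "emeasure (density lborel G) (A n) \<noteq> \<infinity>" for n
    proof -
      have "(\<integral>\<^sup>+z. G z * indicator (A n) z \<partial>lborel) \<le> (\<integral>\<^sup>+z. G z \<partial>lborel)"
        by (intro nn_integral_mono) (auto split: split_indicator)
      then show ?thesis using fin unfolding eA by (auto simp: G_def bergman_int_def top_unique)
    qed
  qed (use A in auto)
  moreover have "emeasure (density lborel G) (\<Inter>n. A n) = 0"
  proof -
    have "z \<notin> (\<Inter>n. A n)" if "z \<in> unit_disk" for z
    proof -
      from that have "0 < 1 - cmod z" by simp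
      then obtain n where n: "inverse (real (Suc n)) < 1 - cmod z" using reals_Archimedean by blast
      have "1 / real (n + 2) \<le> inverse (real (Suc n))" unfolding inverse_eq_divide by (intro frac_le) auto
      then have "cmod z \<le> 1 - 1 / real (n + 2)" using n by linarith
      then show ?thesis by (auto simp: A_def not_less intro!: exI[of _ n])
    qed
    then have "(\<integral>\<^sup>+z. G z * indicator (\<Inter>n. A n) z \<partial>lborel) = (\<integral>\<^sup>+z. 0 \<partial>(lborel :: complex measure))"
      by (intro nn_integral_cong) (auto simp: G_def split: split_indicator)
    then show ?thesis using A G by (subst emeasure_density) auto
  qed
  ultimately have "(\<lambda>n. \<integral>\<^sup>+z. G z * indicator (A n) z \<partial>lborel) \<longlonglongrightarrow> 0" by (simp add: eA)
  then have "eventually (\<lambda>n. (\<integral>\<^sup>+z. G z * indicator (A n) z \<partial>lborel) < ennreal \<epsilon>) sequentially"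
    using \<epsilon> by (intro order_tendstoD(2)) auto
  then obtain n where "(\<integral>\<^sup>+z. G z * indicator (A n) z \<partial>lborel) < ennreal \<epsilon>"
    by (meson eventually_sequentially order_refl)
  then show ?thesis
    by (intro that[of "1 - 1 / real (n + 2)"]) (auto simp: G_def A_def mult_ac)
qed

text \<open>Continuity of rotation in weighted L^p. For |w| <= R the difference is small by uniform
  continuity of (\<zeta>, w) -> \<zeta> g(\<zeta> w) on a compact set; for |w| > R both terms are
  tails, since w and \<zeta> w have equal modulus and hence equal weight.\<close>

lemma bergman_int_rotation_tendsto:
  assumes g: "continuous_on unit_disk g" and p: "0 < p" and \<alpha>: "0 \<le> \<alpha>" and fin: "bergman_int p \<alpha> g < \<infinity>" and \<epsilon>: "0 < \<epsilon>"
  obtains \<delta> where "0 < \<delta>"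
    "\<And>\<zeta>. cmod \<zeta> = 1 \<Longrightarrow> cmod (\<zeta> - 1) < \<delta> \<Longrightarrow> bergman_int p \<alpha> (\<lambda>w. g w - \<zeta> * g (\<zeta> * w)) \<le> ennreal \<epsilon>"
proof -
  \<comment> \<open>Two tails of size \<open>\<eta>\<close>, with the factor 2^p of the triangle
    inequality, add up to \<epsilon>/2.\<close>
  define \<eta> where "\<eta> = \<epsilon> / (4 * 2 powr p)"
  have \<eta>: "0 < \<eta>" using \<epsilon> by (simp add: \<eta>_def)
  define G where "G w = ennreal (cmod (g w) powr p * (1 - (cmod w)\<^sup>2) powr \<alpha>) * indicator unit_disk w" for w
  have G: "G \<in> borel_measurable borel"
    unfolding G_def by (rule bergman_integrand_measurable[OF g p])
  obtain R where R: "0 < R" "R < 1" and "(\<integral>\<^sup>+z\<in>unit_disk. ennreal (cmod (g z) powr p * (1 - (cmod z)\<^sup>2) powr \<alpha>) * indicator {z. R < cmod z} z \<partial>lborel) < ennreal \<eta>"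
    using bergman_int_tail[OF g p fin \<eta>] by blast
  define T where "T w = G w * indicator {z. R < cmod z} w" for w
  have Tm: "T \<in> borel_measurable borel" unfolding T_def using G by measurable
  have T: "(\<integral>\<^sup>+z. T z \<partial>lborel) < ennreal \<eta>"
    using \<open>_ < ennreal \<eta>\<close> by (simp add: T_def G_def mult_ac)
  define V where "V = measure lborel (ball (0::complex) 1)"
  have V: "emeasure lborel (ball (0::complex) 1) = ennreal V" "0 \<le> V"
    using emeasure_lborel_ball_finite[of "0::complex" 1] by (auto simp: V_def emeasure_eq_ennreal_measure)
  \<comment> \<open>Makes \<open>\<kappa> powr p\<close> times the area \<open>V\<close> at most
    \<epsilon>/2, the share of the inner disk.\<close>
  define \<kappa> where "\<kappa> = (\<epsilon> / (2 * (V + 1))) powr (1 / p)"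
  have \<kappa>: "0 < \<kappa>" using \<epsilon> V by (simp add: \<kappa>_def)
  have \<kappa>p: "\<kappa> powr p = \<epsilon> / (2 * (V + 1))" using \<epsilon> V p by (simp add: \<kappa>_def powr_powr)
  have "continuous_on (sphere 0 1 \<times> cball 0 R) (\<lambda>x::complex\<times>complex. fst x * g (fst x * snd x))"
  proof (intro continuous_on_mult continuous_on_compose2[OF g] continuous_on_fst continuous_on_snd continuous_on_id)
    show "(\<lambda>x::complex\<times>complex. fst x * snd x) ` (sphere 0 1 \<times> cball 0 R) \<subseteq> unit_disk"
      using R by (auto simp: norm_mult)
  qed
  then have "uniformly_continuous_on (sphere 0 1 \<times> cball 0 R) (\<lambda>x::complex\<times>complex. fst x * g (fst x * snd x))"
    by (intro compact_uniformly_continuous compact_Times compact_sphere compact_cball)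
  then obtain \<delta> where \<delta>: "0 < \<delta>"
    and u: "\<And>x x'. x \<in> sphere 0 1 \<times> cball 0 R \<Longrightarrow> x' \<in> sphere 0 1 \<times> cball 0 R \<Longrightarrow> dist x' x < \<delta> \<Longrightarrow>
      dist (fst x' * g (fst x' * snd x')) (fst x * g (fst x * snd x)) < \<kappa>"
    using \<kappa> unfolding uniformly_continuous_on_def by metis
  show ?thesis
  proof (rule that[OF \<delta>])
    fix \<zeta> :: complex assume \<zeta>: "cmod \<zeta> = 1" "cmod (\<zeta> - 1) < \<delta>"
    have rot: "(\<lambda>z. \<zeta> * z) \<in> disk_aut" by (rule rotation_in_disk_aut[OF \<zeta>(1)])
    have near: "cmod (g w - \<zeta> * g (\<zeta> * w)) \<le> \<kappa>" if "cmod w \<le> R" for w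
      using u[of "(\<zeta>, w)" "(1, w)"] \<zeta> that by (simp add: dist_Pair_Pair dist_norm norm_minus_commute)
    have pt: "ennreal (cmod (g w - \<zeta> * g (\<zeta> * w)) powr p * (1 - (cmod w)\<^sup>2) powr \<alpha>) * indicator unit_disk w
      \<le> ennreal (\<kappa> powr p) * indicator unit_disk w + ennreal (2 powr p) * (T w + T (\<zeta> * w) * indicator unit_disk w)" (is "?l w \<le> ?r w") for w
    proof (cases "w \<in> unit_disk")
      case True
      note om = bergman_weight_le_1[OF \<alpha> True]
      show ?thesis
      proof (cases "cmod w \<le> R")
        case le: True
        have "cmod (g w - \<zeta> * g (\<zeta> * w)) powr p * (1 - (cmod w)\<^sup>2) powr \<alpha> \<le> \<kappa> powr p * 1"
          using near[OF le] p om by (intro mult_mono powr_mono2) auto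
        then have "ennreal (cmod (g w - \<zeta> * g (\<zeta> * w)) powr p * (1 - (cmod w)\<^sup>2) powr \<alpha>) \<le> ennreal (\<kappa> powr p)"
          by (intro ennreal_leI) simp
        then show ?thesis using True by (simp add: add_increasing2)
      next
        case False
        have "cmod (g w - \<zeta> * g (\<zeta> * w)) powr p * (1 - (cmod w)\<^sup>2) powr \<alpha>
          \<le> 2 powr p * (cmod (g w) powr p + cmod (g (\<zeta> * w)) powr p) * (1 - (cmod w)\<^sup>2) powr \<alpha>"
          using norm_add_powr_le[OF p, of "g w" "- \<zeta> * g (\<zeta> * w)"] \<zeta>
          by (intro mult_right_mono) (auto simp: norm_mult)
        also have "\<dots> = 2 powr p * (cmod (g w) powr p * (1 - (cmod w)\<^sup>2) powr \<alpha> + cmod (g (\<zeta> * w)) powr p * (1 - (cmod (\<zeta> * w))\<^sup>2) powr \<alpha>)"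
          using \<zeta> by (simp add: norm_mult algebra_simps)
        finally have "ennreal (cmod (g w - \<zeta> * g (\<zeta> * w)) powr p * (1 - (cmod w)\<^sup>2) powr \<alpha>) \<le>
          ennreal (2 powr p) * (ennreal (cmod (g w) powr p * (1 - (cmod w)\<^sup>2) powr \<alpha>) + ennreal (cmod (g (\<zeta> * w)) powr p * (1 - (cmod (\<zeta> * w))\<^sup>2) powr \<alpha>))"
          by (subst ennreal_plus[symmetric], simp, simp, subst ennreal_mult[symmetric]) (auto intro: ennreal_leI)
        then show ?thesis using True False \<zeta> by (simp add: T_def G_def norm_mult add_increasing)
      qed
    qed simp
    have T\<zeta>: "(\<lambda>w. T (\<zeta> * w)) \<in> borel_measurable borel"
      using Tm by measurable
    \<comment> \<open>A rotation fixes 0, so its distortion factor is 1.\<close>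
    have "(\<integral>\<^sup>+w\<in>unit_disk. T (\<zeta> * w) \<partial>lborel) \<le> (\<integral>\<^sup>+w\<in>unit_disk. T w \<partial>lborel)"
      using nn_integral_disk_aut_le[OF rot _ _ Tm, of 0] by simp
    also have "\<dots> = (\<integral>\<^sup>+w. T w \<partial>lborel)"
      by (intro nn_integral_cong) (auto simp: T_def G_def split: split_indicator)
    finally have rotT: "(\<integral>\<^sup>+w\<in>unit_disk. T (\<zeta> * w) \<partial>lborel) \<le> ennreal \<eta>" using T by simp
    have "bergman_int p \<alpha> (\<lambda>w. g w - \<zeta> * g (\<zeta> * w)) \<le> (\<integral>\<^sup>+w. ?r w \<partial>lborel)"
      unfolding bergman_int_def by (rule nn_integral_mono[OF pt])
    also have "\<dots> = ennreal (\<kappa> powr p) * ennreal V + ennreal (2 powr p) * ((\<integral>\<^sup>+w. T w \<partial>lborel) + (\<integral>\<^sup>+w\<in>unit_disk. T (\<zeta> * w) \<partial>lborel))"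
    proof -
      have m: "(\<lambda>w. T (\<zeta> * w) * indicator unit_disk w) \<in> borel_measurable lborel" "T \<in> borel_measurable lborel"
        using borel_measurable_times_ennreal[OF T\<zeta> borel_measurable_indicator[of unit_disk borel]] Tm by simp_all
      have m2: "(\<lambda>w. ennreal (2 powr p) * (T w + T (\<zeta> * w) * indicator unit_disk w)) \<in> borel_measurable lborel"
        by (intro borel_measurable_times_ennreal borel_measurable_const borel_measurable_add m)
      have "(\<integral>\<^sup>+w. ?r w \<partial>lborel) = (\<integral>\<^sup>+w. ennreal (\<kappa> powr p) * indicator unit_disk w \<partial>lborel) +
          (\<integral>\<^sup>+w. ennreal (2 powr p) * (T w + T (\<zeta> * w) * indicator unit_disk w) \<partial>lborel)"
        by (intro nn_integral_add m2 borel_measurable_times_ennreal borel_measurable_const borel_measurable_indicator) (unfold sets_lborel, rule borel_open[OF open_ball])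
      also have "(\<integral>\<^sup>+w. ennreal (\<kappa> powr p) * indicator unit_disk w \<partial>lborel) = ennreal (\<kappa> powr p) * ennreal V"
        unfolding V(1)[symmetric] by (rule nn_integral_cmult_indicator) (unfold sets_lborel, rule borel_open[OF open_ball])
      also have "(\<integral>\<^sup>+w. ennreal (2 powr p) * (T w + T (\<zeta> * w) * indicator unit_disk w) \<partial>lborel)
          = ennreal (2 powr p) * (\<integral>\<^sup>+w. T w + T (\<zeta> * w) * indicator unit_disk w \<partial>lborel)"
        by (intro nn_integral_cmult borel_measurable_add m)
      also have "(\<integral>\<^sup>+w. T w + T (\<zeta> * w) * indicator unit_disk w \<partial>lborel) = (\<integral>\<^sup>+w. T w \<partial>lborel) + (\<integral>\<^sup>+w\<in>unit_disk. T (\<zeta> * w) \<partial>lborel)"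
        by (intro nn_integral_add m)
      finally show ?thesis .
    qed
    also have "\<dots> \<le> ennreal (\<kappa> powr p) * ennreal V + ennreal (2 powr p) * (ennreal \<eta> + ennreal \<eta>)"
      using T rotT by (intro add_mono mult_left_mono) auto
    also have "\<dots> = ennreal (\<kappa> powr p * V + 2 powr p * (\<eta> + \<eta>))"
      using V(2) less_imp_le[OF \<eta>] by (simp only: ennreal_mult ennreal_plus mult_nonneg_nonneg powr_ge_zero add_nonneg_nonneg)
    also have "\<dots> \<le> ennreal \<epsilon>"
    proof (rule ennreal_leI)
      have "\<kappa> powr p * V \<le> \<epsilon> / 2"
        unfolding \<kappa>p using V \<epsilon> by (simp add: field_simps)
      moreover have "2 powr p * (\<eta> + \<eta>) = \<epsilon> / 2" by (simp add: \<eta>_def)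
      ultimately show "\<kappa> powr p * V + 2 powr p * (\<eta> + \<eta>) \<le> \<epsilon>" by linarith
    qed
    finally show "bergman_int p \<alpha> (\<lambda>w. g w - \<zeta> * g (\<zeta> * w)) \<le> ennreal \<epsilon>" .
  qed
qed

section \<open>Composition, differences and derivatives of analytic functions on the disk\<close>

lemma analytic_disk_comp: "f \<in> analytic_disk \<Longrightarrow> \<sigma> \<in> disk_aut \<Longrightarrow> f \<circ> \<sigma> \<in> analytic_disk"
  by (auto simp: analytic_disk_def disk_aut_def bij_betw_def intro: holomorphic_on_compose_gen)

lemma analytic_disk_diff: "f \<in> analytic_disk \<Longrightarrow> g \<in> analytic_disk \<Longrightarrow> (\<lambda>z. f z - g z) \<in> analytic_disk"
  by (auto simp: analytic_disk_def intro: holomorphic_intros)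

lemma analytic_disk_dilation:
  assumes "f \<in> analytic_disk" "cmod c \<le> 1"
  shows "(\<lambda>z. f (c * z)) \<in> analytic_disk"
proof -
  have "cmod (c * z) < 1" if "cmod z < 1" for z
    using mult_right_mono[OF assms(2), of "cmod z"] that by (simp add: norm_mult)
  then show ?thesis using assms(1)
    by (auto simp: analytic_disk_def intro!: holomorphic_on_compose_gen[of "\<lambda>z. c * z" unit_disk f unit_disk, unfolded o_def] holomorphic_intros)
qed

lemma continuous_on_deriv_analytic_disk: "f \<in> analytic_disk \<Longrightarrow> continuous_on unit_disk (deriv f)"
  by (auto simp: analytic_disk_def intro!: holomorphic_on_imp_continuous_on holomorphic_deriv)

lemma deriv_analytic_disk_comp:
  assumes "f \<in> analytic_disk" "\<sigma> \<in> disk_aut" "z \<in> unit_disk"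
  shows "deriv (f \<circ> \<sigma>) z = deriv f (\<sigma> z) * deriv \<sigma> z"
proof (rule deriv_chain)
  show "\<sigma> field_differentiable at z"
    using assms by (auto simp: disk_aut_def intro: holomorphic_on_imp_differentiable_at)
  show "f field_differentiable at (\<sigma> z)"
    using assms disk_aut_mem[OF assms(2,3)] by (auto simp: analytic_disk_def intro: holomorphic_on_imp_differentiable_at)
qed

lemma deriv_analytic_disk_diff:
  assumes "f \<in> analytic_disk" "g \<in> analytic_disk" "z \<in> unit_disk"
  shows "deriv (\<lambda>z. f z - g z) z = deriv f z - deriv g z"
  using assms by (intro deriv_diff) (auto simp: analytic_disk_def intro: holomorphic_on_imp_differentiable_at)

text \<open>The second bound writes f as (f - g) + g; it passes estimates from an approximant to
  f.\<close>

lemma bergman_int_deriv_diff_le: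
  assumes f: "f \<in> analytic_disk" and g: "g \<in> analytic_disk" and p: "0 < p"
  shows "bergman_int p \<alpha> (deriv (\<lambda>z. f z - g z)) \<le> ennreal (2 powr p) * (bergman_int p \<alpha> (deriv f) + bergman_int p \<alpha> (deriv g))"
    and "bergman_int p \<alpha> (deriv f) \<le> ennreal (2 powr p) * (bergman_int p \<alpha> (deriv (\<lambda>z. f z - g z)) + bergman_int p \<alpha> (deriv g))"
proof -
  have "bergman_int p \<alpha> (deriv (\<lambda>z. f z - g z)) \<le> ennreal (2 powr p) * (bergman_int p \<alpha> (deriv f) + bergman_int p \<alpha> (\<lambda>z. - deriv g z))"
    by (intro bergman_int_add_le continuous_on_deriv_analytic_disk f g p continuous_on_minus)
       (simp add: deriv_analytic_disk_diff[OF f g])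
  then show "bergman_int p \<alpha> (deriv (\<lambda>z. f z - g z)) \<le> ennreal (2 powr p) * (bergman_int p \<alpha> (deriv f) + bergman_int p \<alpha> (deriv g))"
    by (simp add: bergman_int_def)
  show "bergman_int p \<alpha> (deriv f) \<le> ennreal (2 powr p) * (bergman_int p \<alpha> (deriv (\<lambda>z. f z - g z)) + bergman_int p \<alpha> (deriv g))"
    by (intro bergman_int_add_le continuous_on_deriv_analytic_disk analytic_disk_diff f g p)
       (simp add: deriv_analytic_disk_diff[OF f g])
qed

text \<open>By the chain rule |(f o sigma)'| <= M |sigma'|. In this way the hypothesis on the
  identity function, whose composition with \<open>\<sigma>\<close> is \<open>\<sigma>\<close>,
  controls every polynomial.\<close>

lemma bergman_int_comp_bounded_deriv:
  assumes f: "f \<in> analytic_disk" and \<sigma>: "\<sigma> \<in> disk_aut" and p: "0 < p"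
    and M: "\<And>z. z \<in> unit_disk \<Longrightarrow> cmod (deriv f z) \<le> M"
  shows "bergman_int p \<alpha> (deriv (f \<circ> \<sigma>)) \<le> ennreal (M powr p) * bergman_int p \<alpha> (deriv \<sigma>)"
proof (rule bergman_int_mono)
  fix z assume z: "z \<in> unit_disk"
  have "cmod (deriv (f \<circ> \<sigma>) z) powr p = cmod (deriv f (\<sigma> z)) powr p * cmod (deriv \<sigma> z) powr p"
    using deriv_analytic_disk_comp[OF f \<sigma> z] by (simp add: norm_mult powr_mult)
  also have "\<dots> \<le> M powr p * cmod (deriv \<sigma> z) powr p"
    using M[OF disk_aut_mem[OF \<sigma> z]] p by (intro mult_right_mono powr_mono2) auto
  finally show "cmod (deriv (f \<circ> \<sigma>) z) powr p \<le> M powr p * cmod (deriv \<sigma> z) powr p" .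
next
  show "continuous_on unit_disk (deriv \<sigma>)"
    using \<sigma> by (auto simp: disk_aut_def intro!: holomorphic_on_imp_continuous_on holomorphic_deriv)
qed (use p in auto)

lemma bergman_int_rotation_comp_le:
  assumes f: "f \<in> analytic_disk" and \<sigma>: "\<sigma> \<in> disk_aut" and \<zeta>: "cmod \<zeta> = 1" and p: "0 < p"
  shows "bergman_int p \<alpha> (deriv (\<lambda>z. f (\<sigma> z) - f (\<zeta> * \<sigma> z))) \<le> ennreal (2 powr p) *
    (bergman_int p \<alpha> (deriv (f \<circ> \<sigma>)) + bergman_int p \<alpha> (deriv (f \<circ> ((\<lambda>z. \<zeta> * z) \<circ> \<sigma>))))"
  using bergman_int_deriv_diff_le(1)[OF analytic_disk_comp[OF f \<sigma>] analytic_disk_comp[OF f disk_aut_comp[OF rotation_in_disk_aut[OF \<zeta>] \<sigma>]] p, of \<alpha>]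
  by (simp add: o_def)

context
  fixes p \<alpha> :: real and f :: "complex \<Rightarrow> complex" and B :: real
  assumes p: "1 \<le> p" and \<alpha>: "0 \<le> \<alpha>" and f: "f \<in> analytic_disk"
    and B: "\<And>\<sigma>. \<sigma> \<in> disk_aut \<Longrightarrow> bergman_int p \<alpha> (deriv (f \<circ> \<sigma>)) \<le> ennreal B"
    and vanish: "\<And>\<epsilon>. 0 < \<epsilon> \<Longrightarrow> \<exists>\<rho><1. \<forall>\<sigma>\<in>disk_aut. \<rho> < cmod (\<sigma> 0) \<longrightarrow> bergman_int p \<alpha> (deriv (f \<circ> \<sigma>)) \<le> ennreal \<epsilon>"
begin

text \<open>The assumptions \<open>B\<close> and \<open>vanish\<close> express membership of f in
  the little space through \<open>bergman_int\<close>. The cases are |sigma(0)| <= \<rho>, settled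
  by bounded distortion, and |sigma(0)| > \<rho>, settled by decay.\<close>

lemma bergman_int_rotation_uniform:
  assumes \<epsilon>: "0 < \<epsilon>"
  shows "\<exists>\<delta>>0. \<forall>\<zeta>. cmod \<zeta> = 1 \<longrightarrow> cmod (\<zeta> - 1) < \<delta> \<longrightarrow>
    (\<forall>\<sigma>\<in>disk_aut. bergman_int p \<alpha> (deriv (\<lambda>z. f (\<sigma> z) - f (\<zeta> * \<sigma> z))) \<le> ennreal \<epsilon>)"
proof -
  have p0: "0 < p" using p by simp
  define \<epsilon>' where "\<epsilon>' = \<epsilon> / (2 * 2 powr p)"
  have \<epsilon>': "0 < \<epsilon>'" using \<epsilon> by (simp add: \<epsilon>'_def)
  obtain \<rho>0 where \<rho>0: "\<rho>0 < 1"
    "\<And>\<sigma>. \<sigma> \<in> disk_aut \<Longrightarrow> \<rho>0 < cmod (\<sigma> 0) \<Longrightarrow> bergman_int p \<alpha> (deriv (f \<circ> \<sigma>)) \<le> ennreal \<epsilon>'"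
    using vanish[OF \<epsilon>'] by blast
  \<comment> \<open>The threshold from \<open>vanish\<close> may be negative, while the distortion
    constant \<open>K\<close> must be positive.\<close>
  define \<rho> where "\<rho> = max \<rho>0 0"
  have \<rho>: "0 \<le> \<rho>" "\<rho> < 1" "\<rho>0 \<le> \<rho>" using \<rho>0(1) by (auto simp: \<rho>_def)
  define K where "K = ((1 + \<rho>) / (1 - \<rho>)) powr (p + \<alpha>) * ((1 + \<rho>) / (1 - \<rho>))\<^sup>2"
  have K: "0 < K" using \<rho> by (simp add: K_def)
  have "(\<lambda>z. z) \<in> disk_aut" using rotation_in_disk_aut[of 1] by simp
  from B[OF this] have fin: "bergman_int p \<alpha> (deriv f) < \<infinity>" by (auto simp: o_def intro: le_less_trans)
  obtain \<delta> where \<delta>: "0 < \<delta>"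
    "\<And>\<zeta>. cmod \<zeta> = 1 \<Longrightarrow> cmod (\<zeta> - 1) < \<delta> \<Longrightarrow> bergman_int p \<alpha> (\<lambda>w. deriv f w - \<zeta> * deriv f (\<zeta> * w)) \<le> ennreal (\<epsilon> / K)"
    using bergman_int_rotation_tendsto[OF continuous_on_deriv_analytic_disk[OF f] p0 \<alpha> fin, of "\<epsilon> / K"] \<epsilon> K by auto
  have "bergman_int p \<alpha> (deriv (\<lambda>z. f (\<sigma> z) - f (\<zeta> * \<sigma> z))) \<le> ennreal \<epsilon>"
    if \<zeta>: "cmod \<zeta> = 1" "cmod (\<zeta> - 1) < \<delta>" and \<sigma>: "\<sigma> \<in> disk_aut" for \<zeta> \<sigma>
  proof (cases "cmod (\<sigma> 0) \<le> \<rho>")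
    case True
    have "continuous_on unit_disk (\<lambda>w. deriv f (\<zeta> * w))"
      by (rule continuous_on_compose2[OF continuous_on_deriv_analytic_disk[OF f]])
        (use \<zeta> in \<open>auto simp: norm_mult intro: continuous_intros\<close>)
    then have c: "continuous_on unit_disk (\<lambda>w. deriv f w - \<zeta> * deriv f (\<zeta> * w))"
      by (intro continuous_on_diff continuous_on_mult continuous_on_const continuous_on_deriv_analytic_disk f)
    have "bergman_int p \<alpha> (deriv (\<lambda>z. f (\<sigma> z) - f (\<zeta> * \<sigma> z)))
        = bergman_int p \<alpha> (\<lambda>z. (deriv f (\<sigma> z) - \<zeta> * deriv f (\<zeta> * \<sigma> z)) * deriv \<sigma> z)"
      using \<zeta> by (intro bergman_int_cong deriv_comp_dilation_diff f \<sigma>) auto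
    also have "\<dots> \<le> ennreal K * bergman_int p \<alpha> (\<lambda>w. deriv f w - \<zeta> * deriv f (\<zeta> * w))"
      unfolding K_def by (rule bergman_int_comp_le[OF \<sigma> True \<rho>(2) c p0 \<alpha>])
    also have "\<dots> \<le> ennreal K * ennreal (\<epsilon> / K)" by (intro mult_left_mono \<delta> \<zeta>) simp
    also have "\<dots> = ennreal \<epsilon>" using K \<epsilon> by (simp add: ennreal_mult[symmetric])
    finally show ?thesis .
  next
    case False
    have \<tau>: "(\<lambda>z. \<zeta> * z) \<circ> \<sigma> \<in> disk_aut"
      by (intro disk_aut_comp rotation_in_disk_aut \<zeta> \<sigma>)
    have "bergman_int p \<alpha> (deriv (\<lambda>z. f (\<sigma> z) - f (\<zeta> * \<sigma> z)))
      \<le> ennreal (2 powr p) * (bergman_int p \<alpha> (deriv (f \<circ> \<sigma>)) + bergman_int p \<alpha> (deriv (f \<circ> ((\<lambda>z. \<zeta> * z) \<circ> \<sigma>))))"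
      by (rule bergman_int_rotation_comp_le[OF f \<sigma> \<zeta>(1) p0])
    also have "\<dots> \<le> ennreal (2 powr p) * (ennreal \<epsilon>' + ennreal \<epsilon>')"
      \<comment> \<open>The rotated automorphism has the same modulus at 0, so the decay of f
        applies to both terms.\<close>
      using False \<rho>(3) \<zeta>(1) by (intro mult_left_mono add_mono \<rho>0(2) \<sigma> \<tau>) (auto simp: norm_mult)
    also have "\<dots> = ennreal (2 powr p * (\<epsilon>' + \<epsilon>'))"
      using less_imp_le[OF \<epsilon>'] by (simp only: ennreal_mult ennreal_plus powr_ge_zero add_nonneg_nonneg)
    also have "2 powr p * (\<epsilon>' + \<epsilon>') = \<epsilon>" by (simp add: \<epsilon>'_def)
    finally show ?thesis .
  qed
  with \<delta>(1) show ?thesis by blast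
qed

text \<open>The circle is split at distance \<open>\<delta>\<close> from 1. The near arc contributes
  at most \<epsilon>/2, as the kernel has mass 1; on the far arc the uniform bound \<open>B1\<close>
  meets a kernel that is small for r near 1.\<close>

lemma bergman_int_dilation_uniform:
  assumes \<epsilon>: "0 < \<epsilon>"
  shows "\<exists>r0<1. \<forall>r. r0 < r \<longrightarrow> r < 1 \<longrightarrow>
    (\<forall>\<sigma>\<in>disk_aut. bergman_int p \<alpha> (deriv (\<lambda>z. f (\<sigma> z) - f (of_real r * \<sigma> z))) \<le> ennreal \<epsilon>)"
proof -
  have p0: "0 < p" using p by simp
  obtain \<delta> where \<delta>: "0 < \<delta>" "\<And>\<zeta> \<sigma>. cmod \<zeta> = 1 \<Longrightarrow> cmod (\<zeta> - 1) < \<delta> \<Longrightarrow> \<sigma> \<in> disk_aut \<Longrightarrow>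
     bergman_int p \<alpha> (deriv (\<lambda>z. f (\<sigma> z) - f (\<zeta> * \<sigma> z))) \<le> ennreal (\<epsilon> / 2)"
    using bergman_int_rotation_uniform[of "\<epsilon> / 2"] \<epsilon> by auto
  define B0 where "B0 = max B 0"
  define B1 where "B1 = 2 powr p * (B0 + B0)"
  have B0: "0 \<le> B0" "0 \<le> B1" by (auto simp: B0_def B1_def)
  have bd: "bergman_int p \<alpha> (deriv (\<lambda>z. f (\<sigma> z) - f (\<zeta> * \<sigma> z))) \<le> ennreal B1"
    if \<zeta>: "cmod \<zeta> = 1" and \<sigma>: "\<sigma> \<in> disk_aut" for \<zeta> \<sigma>
  proof -
    have \<tau>: "(\<lambda>z. \<zeta> * z) \<circ> \<sigma> \<in> disk_aut"
      by (intro disk_aut_comp rotation_in_disk_aut \<zeta> \<sigma>)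
    have BB: "ennreal B \<le> ennreal B0" by (intro ennreal_leI) (simp add: B0_def)
    have "bergman_int p \<alpha> (deriv (\<lambda>z. f (\<sigma> z) - f (\<zeta> * \<sigma> z)))
      \<le> ennreal (2 powr p) * (bergman_int p \<alpha> (deriv (f \<circ> \<sigma>)) + bergman_int p \<alpha> (deriv (f \<circ> ((\<lambda>z. \<zeta> * z) \<circ> \<sigma>))))"
      by (rule bergman_int_rotation_comp_le[OF f \<sigma> \<zeta>(1) p0])
    also have "\<dots> \<le> ennreal (2 powr p) * (ennreal B0 + ennreal B0)"
      by (intro mult_left_mono add_mono order_trans[OF B BB] \<sigma> \<tau>) simp
    also have "\<dots> = ennreal B1"
      unfolding B1_def using B0(1) by (simp only: ennreal_mult ennreal_plus powr_ge_zero add_nonneg_nonneg)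
    finally show ?thesis .
  qed
  \<comment> \<open>On the far arc the kernel is at most 2\<eta>/(\<delta>/2)^2 = \<epsilon>/(2(B1 +
    1)), so its product with \<open>B1\<close> stays below \<epsilon>/2.\<close>
  define \<eta> where "\<eta> = \<epsilon> * \<delta>\<^sup>2 / (16 * (B1 + 1))"
  have \<eta>: "0 < \<eta>" using \<epsilon> \<delta> B0 by (simp add: \<eta>_def)
  \<comment> \<open>In turn: r is positive, far points of the circle stay at distance \<delta>/2
    from r, and 1 - r^2 <= 2\<eta>.\<close>
  define r0 where "r0 = max (1/2) (max (1 - \<delta> / 2) (1 - \<eta>))"
  have r0: "r0 < 1" using \<delta> \<eta> by (simp add: r0_def)
  have "bergman_int p \<alpha> (deriv (\<lambda>z. f (\<sigma> z) - f (of_real r * \<sigma> z))) \<le> ennreal \<epsilon>"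
    if r: "r0 < r" "r < 1" and \<sigma>: "\<sigma> \<in> disk_aut" for r \<sigma>
  proof -
    have r': "0 < r" "1 - r < \<delta> / 2" "1 - r < \<eta>" using r by (auto simp: r0_def)
    note nn = poisson_nonneg[OF less_imp_le[OF r'(1)] r(2)]
    have far: "poisson r \<zeta> * B1 \<le> \<epsilon> / 2" if "cmod \<zeta> = 1" "\<delta> \<le> cmod (\<zeta> - 1)" for \<zeta>
    proof -
      have "cmod (\<zeta> - 1) \<le> cmod (\<zeta> - of_real r) + cmod (of_real r - 1)"
        using norm_triangle_ineq[of "\<zeta> - of_real r" "of_real r - 1"] by simp
      moreover have "cmod (of_real r - 1) = 1 - r"
        using r norm_of_real[of "r - 1", where 'a = complex] by (simp del: norm_of_real add: abs_if)
      ultimately have "\<delta> / 2 \<le> cmod (\<zeta> - of_real r)" using that r' by linarith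
      then have "(\<delta> / 2)\<^sup>2 \<le> (cmod (\<zeta> - of_real r))\<^sup>2" using \<delta> by (intro power_mono) auto
      moreover have "1 - r\<^sup>2 \<le> 2 * \<eta>"
      proof -
        have "1 - r\<^sup>2 = (1 + r) * (1 - r)" by (simp add: power2_eq_square algebra_simps)
        also have "\<dots> \<le> 2 * \<eta>" using r r' by (intro mult_mono) auto
        finally show ?thesis .
      qed
      ultimately have "poisson r \<zeta> \<le> 2 * \<eta> / (\<delta> / 2)\<^sup>2"
        unfolding poisson_def using \<eta> \<delta> by (intro frac_le) auto
      then have "poisson r \<zeta> * B1 \<le> 2 * \<eta> / (\<delta> / 2)\<^sup>2 * B1" using B0 by (intro mult_right_mono)
      also have "\<dots> = (\<epsilon> / 2) * (B1 / (B1 + 1))"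
      proof -
        have "\<eta> / \<delta>\<^sup>2 = \<epsilon> / (16 * (B1 + 1))" using \<delta>(1) by (simp add: \<eta>_def)
        moreover have "2 * \<eta> / (\<delta> / 2)\<^sup>2 * B1 = 8 * (\<eta> / \<delta>\<^sup>2) * B1" by (simp add: power_divide)
        ultimately have "2 * \<eta> / (\<delta> / 2)\<^sup>2 * B1 = 8 * (\<epsilon> / (16 * (B1 + 1))) * B1" by simp
        also have "\<dots> = (\<epsilon> / 2) * (B1 / (B1 + 1))" using B0 by (simp add: field_simps)
        finally show ?thesis .
      qed
      also have "\<dots> \<le> \<epsilon> / 2 * 1" using \<epsilon> B0 by (intro mult_left_mono) auto
      finally show ?thesis by simp
    qed
    \<comment> \<open>One majorant for both arcs, with integral exactly \<epsilon> over
      [0,1].\<close>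
    have pt: "ennreal (poisson r (circ t)) * bergman_int p \<alpha> (deriv (\<lambda>z. f (\<sigma> z) - f (circ t * \<sigma> z)))
       \<le> ennreal (poisson r (circ t) * (\<epsilon> / 2) + \<epsilon> / 2)" for t
    proof (cases "cmod (circ t - 1) < \<delta>")
      case True
      have "ennreal (poisson r (circ t)) * bergman_int p \<alpha> (deriv (\<lambda>z. f (\<sigma> z) - f (circ t * \<sigma> z)))
        \<le> ennreal (poisson r (circ t)) * ennreal (\<epsilon> / 2)"
        by (intro mult_left_mono \<delta>(2) True \<sigma>) auto
      also have "\<dots> = ennreal (poisson r (circ t) * (\<epsilon> / 2))" using nn \<epsilon> by (intro ennreal_mult[symmetric]) auto
      also have "\<dots> \<le> ennreal (poisson r (circ t) * (\<epsilon> / 2) + \<epsilon> / 2)" using \<epsilon> by (intro ennreal_leI) auto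
      finally show ?thesis .
    next
      case False
      have "ennreal (poisson r (circ t)) * bergman_int p \<alpha> (deriv (\<lambda>z. f (\<sigma> z) - f (circ t * \<sigma> z)))
        \<le> ennreal (poisson r (circ t)) * ennreal B1"
        by (intro mult_left_mono bd \<sigma>) auto
      also have "\<dots> = ennreal (poisson r (circ t) * B1)" using nn B0 by (intro ennreal_mult[symmetric]) auto
      also have "\<dots> \<le> ennreal (poisson r (circ t) * (\<epsilon> / 2) + \<epsilon> / 2)"
      proof (rule ennreal_leI)
        have "poisson r (circ t) * B1 \<le> \<epsilon> / 2" using False by (intro far) auto
        moreover have "0 \<le> poisson r (circ t) * (\<epsilon> / 2)" using nn \<epsilon> by simp
        ultimately show "poisson r (circ t) * B1 \<le> poisson r (circ t) * (\<epsilon> / 2) + \<epsilon> / 2" by linarith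
      qed
      finally show ?thesis .
    qed
    have "((\<lambda>t. poisson r (circ t) * (\<epsilon> / 2) + \<epsilon> / 2) has_integral (1 * (\<epsilon> / 2) + \<epsilon> / 2)) {0..1}"
      using has_integral_const_real[of "\<epsilon> / 2" 0 1]
      by (intro has_integral_add has_integral_mult_left poisson_integral_1 r' r) simp
    then have "(\<integral>\<^sup>+t. ennreal (poisson r (circ t) * (\<epsilon> / 2) + \<epsilon> / 2) * indicator {0..1} t \<partial>lborel) = ennreal (1 * (\<epsilon> / 2) + \<epsilon> / 2)"
      using nn \<epsilon> by (intro nn_integral_has_integral_lebesgue') auto
    moreover have "bergman_int p \<alpha> (deriv (\<lambda>z. f (\<sigma> z) - f (of_real r * \<sigma> z)))
       \<le> (\<integral>\<^sup>+t\<in>{0..1}. ennreal (poisson r (circ t)) * bergman_int p \<alpha> (deriv (\<lambda>z. f (\<sigma> z) - f (circ t * \<sigma> z))) \<partial>lborel)"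
      by (rule bergman_int_dilation_le[OF f \<sigma> r'(1) r(2) p])
    moreover have "\<dots> \<le> (\<integral>\<^sup>+t\<in>{0..1}. ennreal (poisson r (circ t) * (\<epsilon> / 2) + \<epsilon> / 2) \<partial>lborel)"
      by (intro nn_integral_mono mult_right_mono pt) simp
    ultimately show ?thesis by simp
  qed
  with r0 show ?thesis by blast
qed

end

text \<open>The seminorm sees derivatives only, so it is f' that is expanded. Its power series
  converges absolutely at r, which makes the tail at rz uniformly small for |z| < 1; integrating the
  partial sum of r f'(rz) from the value f(0) gives \<open>q\<close>.\<close>

lemma dilation_polynomial_approx:
  assumes f: "f \<in> analytic_disk" and r: "0 < r" "r < 1" and \<epsilon>: "0 < \<epsilon>"
  obtains q where "poly q 0 = f 0"
    "\<And>z. z \<in> unit_disk \<Longrightarrow> cmod (deriv (\<lambda>z. f (of_real r * z) - poly q z) z) \<le> \<epsilon>"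
proof -
  define g where "g = deriv f"
  have g: "g holomorphic_on ball 0 1"
    using f by (auto simp: g_def analytic_disk_def intro: holomorphic_deriv)
  define b where "b n = (deriv ^^ n) g 0 / fact n" for n
  have s: "(\<lambda>n. b n * w ^ n) sums g w" if "cmod w < 1" for w
    using holomorphic_power_series[OF g, of w] that by (simp add: b_def)
  \<comment> \<open>A point strictly between r and 1: convergence there implies absolute convergence
    at r.\<close>
  have "cmod (of_real ((1 + r) / 2)) < 1" using r by (simp only: norm_of_real) simp
  then have "summable (\<lambda>n. b n * (of_real ((1 + r) / 2)) ^ n)"
    by (rule sums_summable[OF s])
  moreover have "cmod (of_real r) < cmod (of_real ((1 + r) / 2))"
    using r by (simp only: norm_of_real) simp
  ultimately have sn: "summable (\<lambda>n. cmod (b n * (of_real r) ^ n))"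
    by (rule powser_insidea)
  obtain N where N: "\<And>n. N \<le> n \<Longrightarrow> norm (\<Sum>i. cmod (b (i + n) * (of_real r) ^ (i + n))) < \<epsilon>"
    using suminf_exist_split[OF \<epsilon> sn] by blast
  \<comment> \<open>The coefficient of z^(n+1) in the antiderivative of r f'(rz).\<close>
  define c where "c n = of_real r * b n * of_real r ^ n / of_nat (n + 1)" for n
  define q where "q = [:f 0:] + (\<Sum>n<N. monom (c n) (n + 1))"
  have q: "poly q z = f 0 + (\<Sum>n<N. c n * z ^ (n + 1))" for z
    by (simp add: q_def poly_sum poly_monom)
  have "cmod (deriv (\<lambda>z. f (of_real r * z) - poly q z) z) \<le> \<epsilon>" if z: "z \<in> unit_disk" for z
  proof -
    have rz: "cmod (of_real r * z) < 1"
      using z r mult_strict_mono[of r 1 "cmod z" 1] by (simp add: norm_mult)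
    have "(f has_field_derivative g (of_real r * z)) (at (of_real r * z))"
      unfolding g_def using f rz by (intro holomorphic_derivI[of f unit_disk]) (auto simp: analytic_disk_def)
    then have "((\<lambda>z. f (of_real r * z)) has_field_derivative g (of_real r * z) * (of_real r * 1)) (at z)"
      by (rule DERIV_chain2[OF _ DERIV_cmult[OF DERIV_ident]])
    moreover have "((\<lambda>z. f 0 + (\<Sum>n<N. c n * z ^ (n + 1))) has_field_derivative 0 + (\<Sum>n<N. c n * (of_nat (n + 1) * z ^ n))) (at z)"
    proof (intro DERIV_add DERIV_const DERIV_sum DERIV_cmult)
      show "((\<lambda>z. z ^ (n + 1)) has_field_derivative of_nat (n + 1) * z ^ n) (at z)" for n
        using DERIV_power_Suc[OF DERIV_ident, of n z UNIV] by simp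
    qed
    ultimately have "((\<lambda>z. f (of_real r * z) - (f 0 + (\<Sum>n<N. c n * z ^ (n + 1)))) has_field_derivative
        g (of_real r * z) * (of_real r * 1) - (0 + (\<Sum>n<N. c n * (of_nat (n + 1) * z ^ n)))) (at z)"
      by (rule DERIV_diff)
    moreover have cz: "c n * (of_nat (n + 1) * z ^ n) = of_real r * (b n * (of_real r * z) ^ n)" for n
      unfolding c_def by (simp add: power_mult_distrib del: of_nat_Suc of_nat_add)
    ultimately have "deriv (\<lambda>z. f (of_real r * z) - poly q z) z = g (of_real r * z) * (of_real r * 1) - (0 + (\<Sum>n<N. c n * (of_nat (n + 1) * z ^ n)))"
      unfolding q by (intro DERIV_imp_deriv)
    also have "\<dots> = of_real r * (g (of_real r * z) - (\<Sum>n<N. b n * (of_real r * z) ^ n))"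
      unfolding cz by (simp add: sum_distrib_left[symmetric] algebra_simps)
    finally have d: "cmod (deriv (\<lambda>z. f (of_real r * z) - poly q z) z) = r * cmod (g (of_real r * z) - (\<Sum>n<N. b n * (of_real r * z) ^ n))"
      using r by (simp add: norm_mult)
    have "(\<lambda>i. b (i + N) * (of_real r * z) ^ (i + N)) sums (g (of_real r * z) - (\<Sum>n<N. b n * (of_real r * z) ^ n))"
      using sums_split_initial_segment[OF s[OF rz], of N] by simp
    then have e: "g (of_real r * z) - (\<Sum>n<N. b n * (of_real r * z) ^ n) = (\<Sum>i. b (i + N) * (of_real r * z) ^ (i + N))"
      by (simp add: sums_iff)
    have sN: "summable (\<lambda>i. cmod (b (i + N) * (of_real r) ^ (i + N)))"
      using sn by (subst summable_iff_shift)
    have tm: "norm (b (i + N) * (of_real r * z) ^ (i + N)) \<le> cmod (b (i + N) * (of_real r) ^ (i + N))" for i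
      using z r by (simp add: norm_mult norm_power power_mult_distrib mult_left_le power_le_one mult.assoc mult_left_mono)
    have "norm (\<Sum>i. b (i + N) * (of_real r * z) ^ (i + N)) \<le> (\<Sum>i. cmod (b (i + N) * (of_real r) ^ (i + N)))"
      by (rule norm_suminf_le[OF tm sN])
    also have "\<dots> \<le> \<epsilon>" using N[of N] by simp
    finally have "r * cmod (g (of_real r * z) - (\<Sum>n<N. b n * (of_real r * z) ^ n)) \<le> 1 * \<epsilon>"
      unfolding e using r by (intro mult_mono) auto
    then show ?thesis by (simp add: d)
  qed
  moreover have "poly q 0 = f 0" by (simp add: q)
  ultimately show ?thesis using that by blast
qed

subsection \<open>The little space\<close>

lemma tendsto_0_ennreal_iff:
  "(X \<longlongrightarrow> (0::ennreal)) F \<longleftrightarrow> (\<forall>\<epsilon>>0. eventually (\<lambda>x. X x \<le> ennreal \<epsilon>) F)"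
proof (intro iffI allI impI)
  fix \<epsilon> :: real assume X: "(X \<longlongrightarrow> 0) F" and \<epsilon>: "0 < \<epsilon>"
  have "eventually (\<lambda>x. X x < ennreal \<epsilon>) F" by (rule order_tendstoD(2)[OF X]) (use \<epsilon> in simp)
  then show "eventually (\<lambda>x. X x \<le> ennreal \<epsilon>) F" by eventually_elim simp
next
  assume X: "\<forall>\<epsilon>>0. eventually (\<lambda>x. X x \<le> ennreal \<epsilon>) F"
  show "(X \<longlongrightarrow> 0) F"
  proof (rule order_tendstoI)
    fix a :: ennreal assume "0 < a"
    then obtain b where b: "0 < b" "b < a" using dense by blast
    then have "b < top" using less_le_trans top_greatest by blast
    then obtain e where e: "b = ennreal e" "0 \<le> e" by (cases b) auto
    with b have "0 < e" by simp
    with X have "eventually (\<lambda>x. X x \<le> ennreal e) F" by blast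
    then show "eventually (\<lambda>x. X x < a) F" by eventually_elim (use b e in auto)
  qed simp
qed

text \<open>Moves bounds between the norm and its p-th power. At infinity both sides are false, as
  the root of infinity is infinite.\<close>

lemma ennroot_le_iff:
  assumes "0 < p" "0 \<le> \<epsilon>"
  shows "ennroot p x \<le> ennreal \<epsilon> \<longleftrightarrow> x \<le> ennreal (\<epsilon> powr p)"
proof (cases x)
  case (real y)
  have "y powr (1 / p) \<le> \<epsilon> \<longleftrightarrow> y \<le> \<epsilon> powr p"
  proof
    assume "y powr (1 / p) \<le> \<epsilon>"
    then have "(y powr (1 / p)) powr p \<le> \<epsilon> powr p" using assms by (intro powr_mono2) auto
    then show "y \<le> \<epsilon> powr p" using assms real by (simp add: powr_powr)
  next
    assume "y \<le> \<epsilon> powr p"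
    then have "y powr (1 / p) \<le> (\<epsilon> powr p) powr (1 / p)" using assms real by (intro powr_mono2) auto
    then show "y powr (1 / p) \<le> \<epsilon>" using assms by (simp add: powr_powr)
  qed
  then show ?thesis using assms real by (simp add: ennroot_def ennreal_le_iff)
next
  case top
  then show ?thesis by (simp add: ennroot_def top_unique)
qed

lemma ennroot_less_top_iff: "ennroot p x < \<infinity> \<longleftrightarrow> x < \<infinity>"
  by (auto simp: ennroot_def less_top)

lemma M_norm_le_iff:
  assumes "0 < p" "0 \<le> \<epsilon>" "f 0 = 0"
  shows "M_norm p \<mu> f \<le> ennreal \<epsilon> \<longleftrightarrow> (\<forall>\<sigma>\<in>disk_aut. dirichlet_int p \<mu> (f \<circ> \<sigma>) \<le> ennreal (\<epsilon> powr p))"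
  using assms by (simp add: M_norm_def ennroot_le_iff SUP_le_iff)

text \<open>The term |f(0)|^p is finite, so only the supremum decides membership.\<close>

lemma M_space_iff:
  "f \<in> M_space p \<mu> \<longleftrightarrow> f \<in> analytic_disk \<and> (\<exists>B. \<forall>\<sigma>\<in>disk_aut. dirichlet_int p \<mu> (f \<circ> \<sigma>) \<le> ennreal B)"
proof -
  have fin: "x < \<infinity> \<longleftrightarrow> (\<exists>B. x \<le> ennreal B)" for x :: ennreal
    by (cases x) (auto simp: top_unique)
  have "M_norm p \<mu> f < \<infinity> \<longleftrightarrow> (SUP \<sigma>\<in>disk_aut. dirichlet_int p \<mu> (f \<circ> \<sigma>)) < \<infinity>"
    unfolding M_norm_def ennroot_less_top_iff by simp
  also have "\<dots> \<longleftrightarrow> (\<exists>B. \<forall>\<sigma>\<in>disk_aut. dirichlet_int p \<mu> (f \<circ> \<sigma>) \<le> ennreal B)"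
    unfolding fin SUP_le_iff ..
  finally show ?thesis by (simp add: M_space_def)
qed

text \<open>A left neighbourhood of 1 also demands |sigma(0)| < 1, which every automorphism
  satisfies.\<close>

lemma eventually_disk_aut_boundary:
  "eventually P (inf (filtercomap (\<lambda>\<sigma>. cmod (\<sigma> 0)) (at_left 1)) (principal disk_aut))
    \<longleftrightarrow> (\<exists>\<rho><1. \<forall>\<sigma>\<in>disk_aut. \<rho> < cmod (\<sigma> 0) \<longrightarrow> P \<sigma>)"
proof
  assume "eventually P (inf (filtercomap (\<lambda>\<sigma>. cmod (\<sigma> 0)) (at_left 1)) (principal disk_aut))"
  then obtain Q where Q: "eventually Q (at_left (1::real))" "\<And>\<sigma>. Q (cmod (\<sigma> 0)) \<Longrightarrow> \<sigma> \<in> disk_aut \<Longrightarrow> P \<sigma>"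
    unfolding eventually_inf_principal eventually_filtercomap by blast
  from Q(1) obtain \<rho> where "\<rho> < 1" "\<And>y. \<rho> < y \<Longrightarrow> y < 1 \<Longrightarrow> Q y"
    unfolding eventually_at_left_field by blast
  with Q(2) show "\<exists>\<rho><1. \<forall>\<sigma>\<in>disk_aut. \<rho> < cmod (\<sigma> 0) \<longrightarrow> P \<sigma>"
    using disk_aut_mem[of _ 0] by auto
next
  assume "\<exists>\<rho><1. \<forall>\<sigma>\<in>disk_aut. \<rho> < cmod (\<sigma> 0) \<longrightarrow> P \<sigma>"
  then obtain \<rho> where \<rho>: "\<rho> < 1" "\<And>\<sigma>. \<sigma> \<in> disk_aut \<Longrightarrow> \<rho> < cmod (\<sigma> 0) \<Longrightarrow> P \<sigma>" by blast
  have "eventually (\<lambda>y. \<rho> < y) (at_left (1::real))"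
    unfolding eventually_at_left_field using \<rho>(1) by blast
  then show "eventually P (inf (filtercomap (\<lambda>\<sigma>. cmod (\<sigma> 0)) (at_left 1)) (principal disk_aut))"
    unfolding eventually_inf_principal eventually_filtercomap using \<rho>(2) by blast
qed

section \<open>Polynomials on the disk\<close>

lemma poly_in_analytic_disk: "poly q \<in> analytic_disk"
  unfolding analytic_disk_def
  by (auto intro!: derivative_intros simp: holomorphic_on_def field_differentiable_def intro: DERIV_subset[OF poly_DERIV])

lemma poly_deriv_bounded:
  obtains M where "\<And>z. z \<in> unit_disk \<Longrightarrow> cmod (deriv (poly q) z) \<le> M"
proof -
  have "deriv (poly q) z = poly (pderiv q) z" for z by (rule DERIV_imp_deriv[OF poly_DERIV])
  moreover obtain M where "\<And>z. z \<in> cball 0 1 \<Longrightarrow> cmod (poly (pderiv q) z) \<le> M"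
    using continuous_on_compact_bound[OF compact_cball continuous_on_poly[OF continuous_on_id]] by blast
  ultimately show ?thesis by (intro that[of M]) simp
qed

theorem theorem3:
  fixes p \<alpha> C :: real and h :: "real \<Rightarrow> real" and \<mu> :: "complex measure"
    and f :: "complex \<Rightarrow> complex"
  assumes p: "1 \<le> p"
    and h_nonneg: "\<And>r. 0 \<le> r \<Longrightarrow> r < 1 \<Longrightarrow> 0 \<le> h r"
    and h_integrable: "set_integrable lebesgue {0..<1} h"
    and \<alpha>: "0 < \<alpha>" and C: "0 < C"
    and h_aut: "\<And>\<sigma> z. \<sigma> \<in> disk_aut \<Longrightarrow> z \<in> unit_disk \<Longrightarrow>
      h (cmod (\<sigma> z)) \<le> C * h (cmod z) * cmod (deriv \<sigma> z) powr \<alpha>"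
    and \<mu>: "\<mu> = density disk_area (\<lambda>z. ennreal (h (cmod z)))"
    and axiom_D: "standing_axiom p \<mu>"
    and ident: "(\<lambda>z. z) \<in> M0_space p \<mu>"
    and f: "f \<in> analytic_disk"
  shows "(f \<in> M0_space p \<mu> \<longleftrightarrow>
           ((\<lambda>r. M_norm p \<mu> (\<lambda>z. f z - f (complex_of_real r * z))) \<longlongrightarrow> 0) (at_left 1)) \<and>
         (((\<lambda>r. M_norm p \<mu> (\<lambda>z. f z - f (complex_of_real r * z))) \<longlongrightarrow> 0) (at_left 1) \<longleftrightarrow>
           f \<in> M_closure p \<mu> (range poly))"
proof -
  have p0: "0 < p" and \<alpha>0: "0 \<le> \<alpha>" using p \<alpha> by auto
  obtain c1 c2 where c: "0 < c1" "0 < c2"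
    and c1: "\<And>f. f \<in> analytic_disk \<Longrightarrow> bergman_int p \<alpha> (deriv f) \<le> ennreal c1 * dirichlet_int p \<mu> f"
    and c2: "\<And>f. f \<in> analytic_disk \<Longrightarrow> dirichlet_int p \<mu> f \<le> ennreal c2 * bergman_int p \<alpha> (deriv f)"
    using dirichlet_int_comparable[OF p0 C h_integrable h_aut \<mu> radial_weight_0_pos[OF p0 C h_nonneg h_integrable h_aut \<mu> axiom_D]]
    by blast
  \<comment> \<open>The facts that follow restate both spaces and smallness of the norm through
    \<open>J\<close>; \<open>c1\<close> and \<open>c2\<close> only rescale the bounds.\<close>
  define J where "J g \<sigma> = bergman_int p \<alpha> (deriv (g \<circ> \<sigma>))" for g \<sigma> :: "complex \<Rightarrow> complex"
  have J_le: "J g \<sigma> \<le> ennreal (c1 * e)" if "dirichlet_int p \<mu> (g \<circ> \<sigma>) \<le> ennreal e" "g \<in> analytic_disk" "\<sigma> \<in> disk_aut" for g \<sigma> e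
    using order_trans[OF c1[OF analytic_disk_comp[OF that(2,3)]] mult_left_mono[OF that(1), of "ennreal c1"]] c
    by (simp add: J_def ennreal_mult')
  have I_le: "dirichlet_int p \<mu> (g \<circ> \<sigma>) \<le> ennreal (c2 * e)" if "J g \<sigma> \<le> ennreal e" "g \<in> analytic_disk" "\<sigma> \<in> disk_aut" for g \<sigma> e
    using order_trans[OF c2[OF analytic_disk_comp[OF that(2,3)]] mult_left_mono[OF that(1)[unfolded J_def], of "ennreal c2"]] c
    by (simp add: ennreal_mult')
  have M_spaceD: "\<exists>B. \<forall>\<sigma>\<in>disk_aut. J g \<sigma> \<le> ennreal B" if "g \<in> M_space p \<mu>" for g
    using that J_le unfolding M_space_iff by blast
  have M_spaceI: "g \<in> M_space p \<mu>" if "\<And>\<sigma>. \<sigma> \<in> disk_aut \<Longrightarrow> J g \<sigma> \<le> ennreal B" "g \<in> analytic_disk" for g B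
    using that I_le unfolding M_space_iff by blast
  have M0_D: "\<exists>\<rho><1. \<forall>\<sigma>\<in>disk_aut. \<rho> < cmod (\<sigma> 0) \<longrightarrow> J g \<sigma> \<le> ennreal \<epsilon>" if g: "g \<in> M0_space p \<mu>" "0 < \<epsilon>" for g \<epsilon>
  proof -
    have "g \<in> analytic_disk" using g by (simp add: M0_space_def M_space_def)
    moreover have "0 < \<epsilon> / c1" using g c by simp
    then obtain \<rho> where "\<rho> < 1" "\<And>\<sigma>. \<sigma> \<in> disk_aut \<Longrightarrow> \<rho> < cmod (\<sigma> 0) \<Longrightarrow> dirichlet_int p \<mu> (g \<circ> \<sigma>) \<le> ennreal (\<epsilon> / c1)"
      using g(1) unfolding M0_space_def tendsto_0_ennreal_iff eventually_disk_aut_boundary by blast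
    ultimately show ?thesis using J_le[of g _ "\<epsilon> / c1"] c by auto
  qed
  have M0_I: "g \<in> M0_space p \<mu>" if g: "g \<in> M_space p \<mu>"
    "\<And>\<epsilon>. 0 < \<epsilon> \<Longrightarrow> \<exists>\<rho><1. \<forall>\<sigma>\<in>disk_aut. \<rho> < cmod (\<sigma> 0) \<longrightarrow> J g \<sigma> \<le> ennreal \<epsilon>" for g
  proof -
    have ga: "g \<in> analytic_disk" using g by (simp add: M_space_def)
    have "\<exists>\<rho><1. \<forall>\<sigma>\<in>disk_aut. \<rho> < cmod (\<sigma> 0) \<longrightarrow> dirichlet_int p \<mu> (g \<circ> \<sigma>) \<le> ennreal \<epsilon>" if "0 < \<epsilon>" for \<epsilon>
    proof -
      have "0 < \<epsilon> / c2" using that c by simp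
      from g(2)[OF this] show ?thesis using I_le[OF _ ga, of _ "\<epsilon> / c2"] c by auto
    qed
    then show ?thesis using g(1) unfolding M0_space_def tendsto_0_ennreal_iff eventually_disk_aut_boundary by blast
  qed
  \<comment> \<open>\<open>J\<close> does not see constants, hence the condition g(0) = 0, which
    holds for f - f_r and for f - q with q(0) = f(0).\<close>
  have M_norm_small: "M_norm p \<mu> g \<le> ennreal \<epsilon>" if "g \<in> analytic_disk" "g 0 = 0" "0 < \<epsilon>"
    "\<And>\<sigma>. \<sigma> \<in> disk_aut \<Longrightarrow> J g \<sigma> \<le> ennreal (\<epsilon> powr p / c2)" for g \<epsilon>
    using that I_le[of g _ "\<epsilon> powr p / c2"] c p0 by (subst M_norm_le_iff) auto
  have J_small: "J g \<sigma> \<le> ennreal \<epsilon>" if "g \<in> analytic_disk" "0 < \<epsilon>" "M_norm p \<mu> g \<le> ennreal ((\<epsilon> / c1) powr (1 / p))" "\<sigma> \<in> disk_aut" for g \<epsilon> \<sigma>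
  proof -
    have "(SUP \<sigma>\<in>disk_aut. dirichlet_int p \<mu> (g \<circ> \<sigma>)) \<le> ennreal (cmod (g 0) powr p) + (SUP \<sigma>\<in>disk_aut. dirichlet_int p \<mu> (g \<circ> \<sigma>))"
      by (rule add_increasing) auto
    also have "\<dots> \<le> ennreal (\<epsilon> / c1)"
      using that c p0 by (simp add: M_norm_def ennroot_le_iff powr_powr)
    finally have "dirichlet_int p \<mu> (g \<circ> \<sigma>) \<le> ennreal (\<epsilon> / c1)" using that(4) by (simp add: SUP_le_iff)
    from J_le[OF this that(1,4)] show ?thesis using c by simp
  qed
  have J_triangle: "J u \<sigma> \<le> ennreal (2 powr p) * (J (\<lambda>z. u z - v z) \<sigma> + J v \<sigma>)"
    if "u \<in> analytic_disk" "v \<in> analytic_disk" "\<sigma> \<in> disk_aut" for u v \<sigma>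
    using bergman_int_deriv_diff_le(2)[OF analytic_disk_comp[OF that(1,3)] analytic_disk_comp[OF that(2,3)] p0, of \<alpha>]
    by (simp add: J_def o_def)
  have J_triangle': "J u \<sigma> \<le> ennreal \<epsilon>" if "u \<in> analytic_disk" "v \<in> analytic_disk" "\<sigma> \<in> disk_aut" "0 \<le> \<epsilon>"
    "J (\<lambda>z. u z - v z) \<sigma> \<le> ennreal (\<epsilon> / (2 * 2 powr p))" "J v \<sigma> \<le> ennreal (\<epsilon> / (2 * 2 powr p))" for u v \<sigma> \<epsilon>
  proof -
    define e where "e = \<epsilon> / (2 * 2 powr p)"
    have e: "0 \<le> e" using that by (simp add: e_def)
    have "J u \<sigma> \<le> ennreal (2 powr p) * (ennreal e + ennreal e)"
      using order_trans[OF J_triangle[OF that(1-3)] mult_left_mono[OF add_mono[OF that(5,6)]]] by (simp add: e_def)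
    also have "\<dots> = ennreal (2 powr p * (e + e))"
      using e by (simp only: ennreal_mult ennreal_plus powr_ge_zero add_nonneg_nonneg)
    also have "2 powr p * (e + e) = \<epsilon>" by (simp add: e_def)
    finally show ?thesis .
  qed
  have id_comp: "(\<lambda>z. z) \<circ> \<sigma> = \<sigma>" for \<sigma> :: "complex \<Rightarrow> complex" by auto
  \<comment> \<open>Membership of the identity in the M-space, read as a uniform bound on the
    integrals of the automorphisms themselves.\<close>
  obtain B1 where B1: "\<And>\<sigma>. \<sigma> \<in> disk_aut \<Longrightarrow> bergman_int p \<alpha> (deriv \<sigma>) \<le> ennreal B1"
    using M_spaceD[of "\<lambda>z. z"] ident unfolding M0_space_def J_def id_comp by blast
  have J_bounded_deriv: "J g \<sigma> \<le> ennreal (M powr p * e)"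
    if "g \<in> analytic_disk" "\<And>z. z \<in> unit_disk \<Longrightarrow> cmod (deriv g z) \<le> M" "\<sigma> \<in> disk_aut" "bergman_int p \<alpha> (deriv \<sigma>) \<le> ennreal e" for g M \<sigma> e
    using order_trans[OF bergman_int_comp_bounded_deriv[OF that(1,3) p0 that(2)] mult_left_mono[OF that(4)]]
    by (simp add: J_def ennreal_mult')
  have poly_M: "poly q \<in> M_space p \<mu>" for q
  proof -
    obtain M where "\<And>z. z \<in> unit_disk \<Longrightarrow> cmod (deriv (poly q) z) \<le> M" using poly_deriv_bounded by blast
    from J_bounded_deriv[OF poly_in_analytic_disk this _ B1] show ?thesis
      by (intro M_spaceI[OF _ poly_in_analytic_disk]) auto
  qed
  have dil: "(\<lambda>z. f z - f (complex_of_real r * z)) \<in> analytic_disk" "(\<lambda>z. f (complex_of_real r * z)) \<in> analytic_disk"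
    if "0 < r" "r < 1" for r
    using that by (auto intro!: analytic_disk_diff f analytic_disk_dilation)

  have ab: "((\<lambda>r. M_norm p \<mu> (\<lambda>z. f z - f (complex_of_real r * z))) \<longlongrightarrow> 0) (at_left 1)" if M0: "f \<in> M0_space p \<mu>"
    unfolding tendsto_0_ennreal_iff
  proof (intro allI impI)
    fix \<epsilon> :: real assume \<epsilon>: "0 < \<epsilon>"
    obtain B where "\<And>\<sigma>. \<sigma> \<in> disk_aut \<Longrightarrow> J f \<sigma> \<le> ennreal B"
      using M_spaceD[of f] M0 unfolding M0_space_def by blast
    then obtain r0 where r0: "r0 < 1" "\<And>r \<sigma>. r0 < r \<Longrightarrow> r < 1 \<Longrightarrow> \<sigma> \<in> disk_aut \<Longrightarrow>
        bergman_int p \<alpha> (deriv (\<lambda>z. f (\<sigma> z) - f (complex_of_real r * \<sigma> z))) \<le> ennreal (\<epsilon> powr p / c2)"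
      using bergman_int_dilation_uniform[OF p \<alpha>0 f _ M0_D[OF M0, unfolded J_def], of B "\<epsilon> powr p / c2"] \<epsilon> c
      unfolding J_def by auto
    have "M_norm p \<mu> (\<lambda>z. f z - f (complex_of_real r * z)) \<le> ennreal \<epsilon>" if "max r0 0 < r" "r < 1" for r
      using that r0(2)[of r] \<epsilon> dil(1)[of r] by (intro M_norm_small) (auto simp: J_def o_def)
    then show "\<forall>\<^sub>F r in at_left 1. M_norm p \<mu> (\<lambda>z. f z - f (complex_of_real r * z)) \<le> ennreal \<epsilon>"
      unfolding eventually_at_left_field using r0(1) by (intro exI[of _ "max r0 0"]) auto
  qed

  have bc: "f \<in> M_closure p \<mu> (range poly)"
    if lim: "((\<lambda>r. M_norm p \<mu> (\<lambda>z. f z - f (complex_of_real r * z))) \<longlongrightarrow> 0) (at_left 1)"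
  proof -
    have approx: "\<exists>q. poly q 0 = f 0 \<and> (\<forall>\<sigma>\<in>disk_aut. J (\<lambda>z. f z - poly q z) \<sigma> \<le> ennreal \<epsilon>)" if \<epsilon>: "0 < \<epsilon>" for \<epsilon>
    proof -
      define e where "e = \<epsilon> / (2 * 2 powr p)"
      have e: "0 < e" using \<epsilon> by (simp add: e_def)
      have "0 < (e / c1) powr (1 / p)" using e c by simp
      then have "\<forall>\<^sub>F r in at_left 1. M_norm p \<mu> (\<lambda>z. f z - f (complex_of_real r * z)) \<le> ennreal ((e / c1) powr (1 / p))"
        using lim unfolding tendsto_0_ennreal_iff by blast
      then obtain b where b: "b < 1" "\<And>r. b < r \<Longrightarrow> r < 1 \<Longrightarrow>
          M_norm p \<mu> (\<lambda>z. f z - f (complex_of_real r * z)) \<le> ennreal ((e / c1) powr (1 / p))"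
        unfolding eventually_at_left_field by blast
      obtain r where r: "max b 0 < r" "r < 1" using dense[of "max b 0" 1] b(1) by auto
      then have r': "0 < r" "b < r" by auto
      have Jr: "J (\<lambda>z. f z - f (complex_of_real r * z)) \<sigma> \<le> ennreal e" if "\<sigma> \<in> disk_aut" for \<sigma>
        by (rule J_small[OF dil(1)[OF r'(1) r(2)] e b(2)[OF r'(2) r(2)] that])
      \<comment> \<open>The tolerance for derivatives, chosen so that \<kappa>^p B1 <= e;
        \<open>B1\<close> may be 0 or negative, hence |B1| + 1.\<close>
      define \<kappa> where "\<kappa> = (e / (\<bar>B1\<bar> + 1)) powr (1 / p)"
      have \<kappa>: "0 < \<kappa>" using e by (simp add: \<kappa>_def)
      have "\<kappa> powr p * B1 = e * (B1 / (\<bar>B1\<bar> + 1))" using e p0 by (simp add: \<kappa>_def powr_powr)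
      also have "\<dots> \<le> e * 1" using e by (intro mult_left_mono) (auto simp: divide_le_eq)
      finally have \<kappa>B: "\<kappa> powr p * B1 \<le> e" by simp
      obtain q where q: "poly q 0 = f 0"
        "\<And>z. z \<in> unit_disk \<Longrightarrow> cmod (deriv (\<lambda>z. f (complex_of_real r * z) - poly q z) z) \<le> \<kappa>"
        using dilation_polynomial_approx[OF f r'(1) r(2) \<kappa>] by blast
      have rq: "(\<lambda>z. f (complex_of_real r * z) - poly q z) \<in> analytic_disk"
        by (intro analytic_disk_diff dil(2) r' r poly_in_analytic_disk)
      have "J (\<lambda>z. f z - poly q z) \<sigma> \<le> ennreal \<epsilon>" if \<sigma>: "\<sigma> \<in> disk_aut" for \<sigma>
      proof (rule J_triangle'[OF analytic_disk_diff[OF f poly_in_analytic_disk] rq \<sigma>])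
        show "J (\<lambda>z. f z - poly q z - (f (complex_of_real r * z) - poly q z)) \<sigma> \<le> ennreal (\<epsilon> / (2 * 2 powr p))"
          using Jr[OF \<sigma>] by (simp add: e_def)
        show "J (\<lambda>z. f (complex_of_real r * z) - poly q z) \<sigma> \<le> ennreal (\<epsilon> / (2 * 2 powr p))"
          using order_trans[OF J_bounded_deriv[OF rq q(2) \<sigma> B1[OF \<sigma>]] ennreal_leI[OF \<kappa>B]] by (simp add: e_def)
      qed (use \<epsilon> in simp)
      then show ?thesis using q(1) by blast
    qed
    \<comment> \<open>Statement (b) mentions differences only, so membership of f in the M-space is
      derived: f is within \<open>J\<close>-distance 1 of a polynomial, uniformly in
      \<open>\<sigma>\<close>.\<close>
    have fM: "f \<in> M_space p \<mu>"
    proof -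
      obtain q where q: "\<And>\<sigma>. \<sigma> \<in> disk_aut \<Longrightarrow> J (\<lambda>z. f z - poly q z) \<sigma> \<le> ennreal 1"
        using approx[of 1] by auto
      obtain B where B: "\<And>\<sigma>. \<sigma> \<in> disk_aut \<Longrightarrow> J (poly q) \<sigma> \<le> ennreal B"
        using M_spaceD[OF poly_M] by blast
      \<comment> \<open>After division by the factor 2 * 2^p of \<open>J_triangle'\<close> there
        remains |B| + 1, which dominates both 1 and \<open>B\<close>.\<close>
      define D where "D = 2 * 2 powr p * (\<bar>B\<bar> + 1)"
      have D: "D / (2 * 2 powr p) = \<bar>B\<bar> + 1" "0 \<le> D" by (simp_all add: D_def)
      show ?thesis
      proof (rule M_spaceI[OF _ f])
        fix \<sigma> assume \<sigma>: "\<sigma> \<in> disk_aut"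
        show "J f \<sigma> \<le> ennreal D"
        proof (rule J_triangle'[OF f poly_in_analytic_disk \<sigma> D(2)])
          show "J (\<lambda>z. f z - poly q z) \<sigma> \<le> ennreal (D / (2 * 2 powr p))"
            unfolding D(1) by (rule order_trans[OF q[OF \<sigma>]]) (simp add: ennreal_leI del: ennreal_1)
          show "J (poly q) \<sigma> \<le> ennreal (D / (2 * 2 powr p))"
            unfolding D(1) by (rule order_trans[OF B[OF \<sigma>]]) (intro ennreal_leI, simp)
        qed
      qed
    qed
    have "\<exists>g\<in>range poly \<inter> M_space p \<mu>. M_norm p \<mu> (\<lambda>z. f z - g z) < \<epsilon>" if \<epsilon>: "0 < \<epsilon>" for \<epsilon>
    proof -
      \<comment> \<open>The tolerance in \<open>M_closure\<close> is an extended real, possibly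
        infinite; a smaller finite one also gives the strict inequality.\<close>
      obtain b where b: "0 < b" "b < \<epsilon>" using dense[OF \<epsilon>] by blast
      then have "b < top" using less_le_trans top_greatest by blast
      then obtain e where e: "b = ennreal e" "0 \<le> e" by (cases b) auto
      with b have e0: "0 < e" by simp
      then have "0 < e powr p / c2" using c by simp
      from approx[OF this] obtain q where q: "poly q 0 = f 0"
        "\<And>\<sigma>. \<sigma> \<in> disk_aut \<Longrightarrow> J (\<lambda>z. f z - poly q z) \<sigma> \<le> ennreal (e powr p / c2)" by blast
      have "M_norm p \<mu> (\<lambda>z. f z - poly q z) \<le> ennreal e"
        by (rule M_norm_small[OF analytic_disk_diff[OF f poly_in_analytic_disk] _ e0 q(2)]) (simp add: q(1))
      then show ?thesis using b e poly_M[of q] by (intro bexI[of _ "poly q"]) auto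
    qed
    then show ?thesis using fM by (simp add: M_closure_def)
  qed

  \<comment> \<open>The distance from f to the polynomial is small uniformly in
    \<open>\<sigma>\<close>, and the polynomial decays because its integral is at most M^p times
    that of \<open>\<sigma>\<close>.\<close>
  have ca: "f \<in> M0_space p \<mu>" if cl: "f \<in> M_closure p \<mu> (range poly)"
  proof (rule M0_I)
    show "f \<in> M_space p \<mu>" using cl by (simp add: M_closure_def)
    fix \<epsilon> :: real assume \<epsilon>: "0 < \<epsilon>"
    define e where "e = \<epsilon> / (2 * 2 powr p)"
    have e: "0 < e" using \<epsilon> by (simp add: e_def)
    have "0 < ennreal ((e / c1) powr (1 / p))" using e c by simp
    then obtain q where q: "M_norm p \<mu> (\<lambda>z. f z - poly q z) < ennreal ((e / c1) powr (1 / p))"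
      using cl unfolding M_closure_def by blast
    obtain M where M: "\<And>z. z \<in> unit_disk \<Longrightarrow> cmod (deriv (poly q) z) \<le> M" using poly_deriv_bounded by blast
    \<comment> \<open>The decay of the identity is requested at level e/(M^p + 1), which is
      meaningful even for a constant polynomial with M = 0.\<close>
    have Mp: "0 < M powr p + 1" by (simp add: add_nonneg_pos)
    obtain \<rho> where \<rho>: "\<rho> < 1" "\<And>\<sigma>. \<sigma> \<in> disk_aut \<Longrightarrow> \<rho> < cmod (\<sigma> 0) \<Longrightarrow> bergman_int p \<alpha> (deriv \<sigma>) \<le> ennreal (e / (M powr p + 1))"
      using M0_D[OF ident, of "e / (M powr p + 1)"] e Mp unfolding J_def id_comp by auto
    have "J f \<sigma> \<le> ennreal \<epsilon>" if \<sigma>: "\<sigma> \<in> disk_aut" "\<rho> < cmod (\<sigma> 0)" for \<sigma>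
    proof (rule J_triangle'[OF f poly_in_analytic_disk \<sigma>(1)])
      show "J (\<lambda>z. f z - poly q z) \<sigma> \<le> ennreal (\<epsilon> / (2 * 2 powr p))"
        unfolding e_def[symmetric] by (rule J_small[OF analytic_disk_diff[OF f poly_in_analytic_disk] e less_imp_le[OF q] \<sigma>(1)])
      have "M powr p * (e / (M powr p + 1)) = e * (M powr p / (M powr p + 1))" by simp
      also have "\<dots> \<le> e * 1" using e Mp by (intro mult_left_mono) (auto simp: divide_le_eq)
      finally have Me: "M powr p * (e / (M powr p + 1)) \<le> e" by simp
      show "J (poly q) \<sigma> \<le> ennreal (\<epsilon> / (2 * 2 powr p))"
        unfolding e_def[symmetric]
        by (rule order_trans[OF J_bounded_deriv[OF poly_in_analytic_disk M \<sigma>(1) \<rho>(2)[OF \<sigma>]] ennreal_leI[OF Me]])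
    qed (use \<epsilon> in simp)
    with \<rho>(1) show "\<exists>\<rho><1. \<forall>\<sigma>\<in>disk_aut. \<rho> < cmod (\<sigma> 0) \<longrightarrow> J f \<sigma> \<le> ennreal \<epsilon>" by blast
  qed

  from ab bc ca show ?thesis by blast
qed

end
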